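(* Let $M$ be a multigraph and let $H$ be a graph obtained from $M$ by subdividing each edge of $M$ at least $\ell$ times (different edges may be subdivided different numbers of times). If $\ell=2$ and $M$ is loopless, then $g_3(H)\leq 2$ and $h_4(H)=1$. If $\ell=3$, then $h_3(H)\leq 2$.
   Context: Subdividing an edge $t$ times replaces it (including a loop) by a path whose $t$ new internal vertices have degree $2$; such an $H$ is $3$-colorable. For a graph $H$ and an integer $k\geq\chi(H)$, a proper $k$-coloring of $H$ is a map $\phi:V(H)\to[k]$ with $\phi(u)\neq\phi(v)$ for every edge $uv$. For a positive integer $j$, $G^j_k(H)$ is the graph whose vertices are the proper $k$-colorings of $H$, two distinct colorings being adjacent if $H$ contains a connected subgraph on at most $j$ vertices containing every vertex on which the two colorings differ. $g_k(H)$ is the least positive integer $j$ such that $G^j_k(H)$ is connected, and $h_k(H)$ is the least positive integer $j$ such that $G^j_k(H)$ is Hamiltonian (complete graphs are regarded as Hamiltonian). *)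

theory Defs
  imports "Graph_Theory.Graph_Theory" "HOL-Library.FuncSet" "HOL-Library.Extended_Nat"
begin

text \<open>
  A finite undirected multigraph, loops and parallel edges allowed, is given as a
  \<^locale>\<open>fin_digraph\<close> with exactly one arc per edge.  The orientation of an arc is
  arbitrary: nothing below depends on it.  It is loopless iff it is a
  \<^locale>\<open>loopfree_digraph\<close>.  Simple graphs are symmetric irreflexive
  \<^typ>\<open>'a pair_pre_digraph\<close>s, as in \<^locale>\<open>pair_graph\<close>.
\<close>

definition path_arcs :: "'a list \<Rightarrow> 'a rel" where
  "path_arcs q = set (zip q (tl q)) \<union> (set (zip q (tl q)))\<inverse>"

text \<open>
  \<open>H\<close> arises from \<open>M\<close> by subdividing each edge \<open>e\<close> exactly \<open>t e\<close> times; \<open>p e\<close> lists the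
  new vertices along \<open>e\<close>.  If some \<open>t e\<close> is below 2, loops may survive and parallel edges
  may be merged; this is only meant to be used with \<open>t e \<ge> 2\<close>, where \<open>H\<close> is a simple graph.
\<close>

definition is_subdivision ::
  "('a, 'e) pre_digraph \<Rightarrow> ('e \<Rightarrow> nat) \<Rightarrow> 'a pair_pre_digraph \<Rightarrow> bool" where
  "is_subdivision M t H \<longleftrightarrow> (\<exists>p :: 'e \<Rightarrow> 'a list.
      (\<forall>e \<in> arcs M. length (p e) = t e \<and> distinct (p e) \<and> set (p e) \<inter> verts M = {})
    \<and> (\<forall>e \<in> arcs M. \<forall>f \<in> arcs M. e \<noteq> f \<longrightarrow> set (p e) \<inter> set (p f) = {})
    \<and> pverts H = verts M \<union> (\<Union>e \<in> arcs M. set (p e))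
    \<and> parcs H = (\<Union>e \<in> arcs M. path_arcs (tail M e # p e @ [head M e])))"

text \<open>Colorings are extensional, so distinct colorings differ on some vertex of \<open>H\<close>.\<close>

definition proper_colorings :: "nat \<Rightarrow> 'a pair_pre_digraph \<Rightarrow> ('a \<Rightarrow> nat) set" where
  "proper_colorings k H =
    {\<phi> \<in> pverts H \<rightarrow>\<^sub>E {1..k}. \<forall>(u, v) \<in> parcs H. \<phi> u \<noteq> \<phi> v}"

definition coloring_graph ::
  "nat \<Rightarrow> nat \<Rightarrow> 'a pair_pre_digraph \<Rightarrow> ('a \<Rightarrow> nat) pair_pre_digraph" where
  "coloring_graph k j H = \<lparr>
    pverts = proper_colorings k H,
    parcs = {(\<phi>, \<psi>). \<phi> \<in> proper_colorings k H \<and> \<psi> \<in> proper_colorings k H \<and> \<phi> \<noteq> \<psi> \<and>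
      (\<exists>S :: 'a pair_pre_digraph.
          pair_graph S \<and> subgraph (with_proj S) (with_proj H) \<and> connected (with_proj S)
        \<and> card (pverts S) \<le> j \<and> {v \<in> pverts H. \<phi> v \<noteq> \<psi> v} \<subseteq> pverts S)} \<rparr>"

text \<open>
  In a symmetric digraph \<^const>\<open>pre_digraph.cycle\<close> admits walks \<open>u, v, u\<close>, hence the
  length bound.  Nonempty complete graphs, in particular on one or two vertices, are
  Hamiltonian by convention; the null graph is neither connected nor Hamiltonian.
\<close>

definition hamiltonian :: "'a pair_pre_digraph \<Rightarrow> bool" where
  "hamiltonian G \<longleftrightarrow>
      (pverts G \<noteq> {} \<and> complete_digraph (card (pverts G)) (with_proj G))
    \<or> (\<exists>c. pre_digraph.cycle (with_proj G) c \<and> 3 \<le> length c \<and> fst ` set c = pverts G)"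

text \<open>
  The least positive \<open>j\<close>, as an extended natural number: the value is \<open>\<infinity>\<close> if no such \<open>j\<close>
  exists (for instance, if \<open>H\<close> has no proper \<open>k\<close>-coloring).
\<close>

definition gray_g :: "nat \<Rightarrow> 'a pair_pre_digraph \<Rightarrow> enat" where
  "gray_g k H = (INF j \<in> {j. 1 \<le> j \<and> connected (with_proj (coloring_graph k j H))}. enat j)"

definition gray_h :: "nat \<Rightarrow> 'a pair_pre_digraph \<Rightarrow> enat" where
  "gray_h k H = (INF j \<in> {j. 1 \<le> j \<and> hamiltonian (coloring_graph k j H)}. enat j)"

end

theory Submission
  imports Defs
begin

text \<open>Choosing the \<open>c\<^sub>i\<close> one after the other is easy; the difficulty is to
  be back at the first one after a full round. If distinct elements are always joined and
  consecutive fibres share two of them, the only forbidden move is to leave a fibre where it was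
  entered, and the round closes as soon as no element lies in all fibres. If some pairs are not
  joined, one follows the whole set of elements reachable from a start and shows that it stays
  large. Both arguments need certain states to occur on the cycle, so the ends of an ear are kept
  free to take all admissible pairs of colors. The pendant paths owe their length to the two common
  elements. With 4 colors a leaf has 3 admissible colors, and two such sets share at least 2. With 3
  colors two fibres of a leaf may share a single color, which is enough for connectivity but leaves
  no choice; two pendant vertices give fibres of 4 elements, any two of which share at least 2.
  Removing two vertices at a time leaves ears of length 3 or 4 according to parity.\<close>

text \<open>
  Delete the interior of a path of \<open>H\<close>. A coloring of \<open>H\<close> is a coloring \<open>\<phi>\<close> of the remaining graph
  together with a list of colors along the path, which ranges over a fibre depending only on the
  colors that \<open>\<phi>\<close> gives to the attachment vertices (the state of \<open>\<phi>\<close>). A Hamiltonian cycle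
  \<open>\<phi>\<^sub>1, \<phi>\<^sub>2, \<dots>\<close> of colorings of the remaining graph lifts to \<open>H\<close> as soon as one can choose \<open>c\<^sub>i\<close> in the
  fibres of both \<open>\<phi>\<^sub>i\<close> and \<open>\<phi>\<^sub>i\<^sub>+\<^sub>1\<close> such that \<open>c\<^sub>i\<^sub>-\<^sub>1\<close> and \<open>c\<^sub>i\<close> are the ends of a Hamiltonian path of the
  fibre of \<open>\<phi>\<^sub>i\<close>. So \<open>H\<close> is built from its branch vertices, first
  as isolated vertices, then ear by ear. A long ear is first shortened by attaching pendant paths,
  with one vertex (for \<open>g\<^sub>3\<close> and \<open>h\<^sub>4\<close>) or two vertices (for \<open>h\<^sub>3\<close>); there remain ears with 2 internal
  vertices in the first case and with 3 or 4 in the second. Their fibres have at most 11 elements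
  and are examined exhaustively.
\<close>

section \<open>Closed chains of fibres\<close>

text \<open>\<open>T \<sigma> s d\<close> stands for a traversal of the fibre of
  \<open>\<sigma>\<close> from \<open>s\<close> to \<open>d\<close>; the exit \<open>d\<close> is
  also the entrance to the next fibre.\<close>

fun chain :: "('s \<Rightarrow> 'c \<Rightarrow> 'c \<Rightarrow> bool) \<Rightarrow> 'c \<Rightarrow> 's list \<Rightarrow> 'c \<Rightarrow> bool" where
  "chain T s [] e \<longleftrightarrow> s = e"
| "chain T s (\<sigma> # ss) e \<longleftrightarrow> (\<exists>d. T \<sigma> s d \<and> chain T d ss e)"

definition closed_chain :: "('s \<Rightarrow> 'c \<Rightarrow> 'c \<Rightarrow> bool) \<Rightarrow> 's list \<Rightarrow> bool" where
  "closed_chain T ss \<longleftrightarrow> (\<exists>s. chain T s ss s)"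

definition cyclically :: "('s \<Rightarrow> 's \<Rightarrow> bool) \<Rightarrow> 's list \<Rightarrow> bool" where
  "cyclically R ss \<longleftrightarrow> successively R ss \<and> R (last ss) (hd ss)"

lemma chain_append: "chain T s (ss @ ts) e \<longleftrightarrow> (\<exists>d. chain T s ss d \<and> chain T d ts e)"
  by (induction ss arbitrary: s) auto

lemma closed_chain_rotate: "closed_chain T (ts @ ss) \<Longrightarrow> closed_chain T (ss @ ts)"
  unfolding closed_chain_def chain_append by blast

lemma cyclically_rotate: "cyclically R (ts @ ss) \<Longrightarrow> cyclically R (ss @ ts)"
  unfolding cyclically_def
  by (cases "ss = []"; cases "ts = []") (auto simp: successively_append_iff)

lemma chain_greedy:
  assumes step: "\<And>\<sigma> \<tau> s. \<sigma> \<in> A \<Longrightarrow> \<tau> \<in> A \<Longrightarrow> allowed \<sigma> \<tau> \<Longrightarrow> s \<in> D \<sigma> \<Longrightarrow> \<exists>e\<in>D \<sigma> \<inter> D \<tau>. T \<sigma> s e"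
    and "successively allowed (\<sigma> # ss @ [\<tau>])" "set (\<sigma> # ss @ [\<tau>]) \<subseteq> A" "s \<in> D \<sigma>"
  shows "\<exists>e\<in>D (last (\<sigma> # ss)) \<inter> D \<tau>. chain T s (\<sigma> # ss) e"
  using assms(2-)
proof (induction ss arbitrary: \<sigma> s)
  case Nil
  then show ?case using step[of \<sigma> \<tau> s] by simp
next
  case (Cons \<rho> ss)
  then obtain d where d: "d \<in> D \<sigma> \<inter> D \<rho>" "T \<sigma> s d"
    using step[of \<sigma> \<rho> s] by auto
  then obtain e where "e \<in> D (last (\<rho> # ss)) \<inter> D \<tau>" "chain T d (\<rho> # ss) e"
    using Cons.IH[of \<rho> d] Cons.prems by auto
  then have "e \<in> D (last (\<sigma> # \<rho> # ss)) \<inter> D \<tau>" "chain T s (\<sigma> # \<rho> # ss) e"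
    using d(2) by auto
  then show ?case by blast
qed

lemma closed_chain_avoiding:
  assumes cyc: "cyclically allowed ss" and len: "2 \<le> length ss" and A: "set ss \<subseteq> A"
    and T: "\<And>\<sigma> s e. \<sigma> \<in> A \<Longrightarrow> s \<in> D \<sigma> \<Longrightarrow> e \<in> D \<sigma> \<Longrightarrow> s \<noteq> e \<Longrightarrow> T \<sigma> s e"
    and two: "\<And>\<sigma> \<tau>. \<sigma> \<in> A \<Longrightarrow> \<tau> \<in> A \<Longrightarrow> allowed \<sigma> \<tau> \<Longrightarrow> \<exists>c d. c \<noteq> d \<and> {c, d} \<subseteq> D \<sigma> \<inter> D \<tau>"
    and avoid: "\<And>c. \<exists>\<tau>\<in>set ss. c \<notin> D \<tau>"
  shows "closed_chain T ss"
proof -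
  have "hd ss \<in> set ss" "last ss \<in> set ss" "allowed (last ss) (hd ss)"
    using len cyc by (cases ss; simp add: cyclically_def)+
  then obtain c where c: "c \<in> D (last ss)" "c \<in> D (hd ss)"
    using two[of "last ss" "hd ss"] A by auto
  obtain \<tau> where "\<tau> \<in> set ss" "c \<notin> D \<tau>" using avoid by blast
  \<comment> \<open>\<open>\<rho>\<close> is the last state that misses \<open>c\<close>. Start with \<open>c\<close> just after the state \<open>\<sigma>\<close> that follows \<open>\<rho>\<close>: whichever element enters \<open>\<sigma>\<close> then differs from \<open>c\<close>, so the chain can be closed.\<close>
  then obtain ys \<rho> zs where ss: "ss = ys @ \<rho> # zs" and \<rho>: "c \<notin> D \<rho>" and zs: "\<forall>z\<in>set zs. c \<in> D z"
    using split_list_last_prop[of ss "\<lambda>x. c \<notin> D x"] by auto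
  \<comment> \<open>\<open>c\<close> lies in the fibres of the first and the last state, so
    \<open>\<rho>\<close> is neither of them, and the rotated list still begins with a state whose
    fibre contains \<open>c\<close>.\<close>
  have zs0: "zs \<noteq> []" using ss \<rho> c(1) by (cases zs) auto
  have ys0: "ys \<noteq> []" using ss \<rho> c(2) by (cases ys) auto
  obtain \<sigma> vs where zs_eq: "zs = \<sigma> # vs" using zs0 by (cases zs) auto
  let ?ts = "vs @ ys @ [\<rho>]"
  have cyc': "cyclically allowed (?ts @ [\<sigma>])"
    using cyclically_rotate[of allowed "ys @ [\<rho>, \<sigma>]" vs] cyc unfolding ss zs_eq by simp
  obtain \<upsilon> us where ts: "?ts = \<upsilon> # us" by (cases ?ts) auto
  have \<upsilon>: "c \<in> D \<upsilon>"
  proof -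
    have "\<upsilon> = (if vs = [] then hd ys else hd vs)" using ts ys0 by (cases vs; cases ys) auto
    then show ?thesis using zs zs_eq c(2) ss ys0 by (cases vs) auto
  qed
  have "\<exists>e\<in>D (last (\<upsilon> # us)) \<inter> D \<sigma>. chain T c (\<upsilon> # us) e"
  proof (rule chain_greedy[where A = A and allowed = allowed])
    fix \<sigma> \<tau> s assume "\<sigma> \<in> A" "\<tau> \<in> A" "allowed \<sigma> \<tau>" "s \<in> D \<sigma>"
    moreover from this obtain a b where "a \<noteq> b" "{a, b} \<subseteq> D \<sigma> \<inter> D \<tau>"
      using two[of \<sigma> \<tau>] by blast
    ultimately show "\<exists>e\<in>D \<sigma> \<inter> D \<tau>. T \<sigma> s e"
      using T[of \<sigma> s a] T[of \<sigma> s b] by (cases "s = a") blast+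
  next
    show "successively allowed (\<upsilon> # us @ [\<sigma>])"
      using cyc' unfolding ts by (simp add: cyclically_def)
    show "set (\<upsilon> # us @ [\<sigma>]) \<subseteq> A"
    proof -
      have "set (\<upsilon> # us) = set ?ts" using ts by simp
      then show ?thesis using A ss zs_eq by auto
    qed
    show "c \<in> D \<upsilon>" by fact
  qed
  moreover have "last (\<upsilon> # us) = \<rho>" unfolding ts[symmetric] by simp
  ultimately obtain e where e: "e \<in> D \<rho>" "e \<in> D \<sigma>" "chain T c ?ts e" using ts by auto
  have "T \<sigma> e c" using T[of \<sigma> e c] e(1,2) \<rho> zs A unfolding zs_eq ss by auto
  with e(3) have "chain T c (?ts @ [\<sigma>]) c" by (subst chain_append) auto
  then have "closed_chain T (vs @ (ys @ [\<rho>, \<sigma>]))" unfolding closed_chain_def by auto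
  from closed_chain_rotate[OF this] show ?thesis using ss zs_eq by simp
qed

text \<open>Two steps through a third element connect \<open>s\<close> and \<open>e\<close>, equal
  or not. This serves an isolated vertex, where all fibres coincide and
  \<open>closed_chain_avoiding\<close> cannot apply.\<close>

lemma chain_replicate:
  assumes T: "\<And>s e. s \<in> D \<Longrightarrow> e \<in> D \<Longrightarrow> s \<noteq> e \<Longrightarrow> T \<sigma> s e"
    and D: "3 \<le> card D" and "s \<in> D" "e \<in> D"
  shows "chain T s (replicate (Suc (Suc n)) \<sigma>) e"
  using assms(3)
proof (induction n arbitrary: s)
  case 0
  have "finite D" using D by (metis card.infinite not_numeral_le_zero)
  have "\<not> D \<subseteq> {s, e}"
    using card_mono[of "{s, e}" D] card_insert_le_m1[of 2 "{e}" s] D by auto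
  then obtain d where "d \<in> D" "d \<noteq> s" "d \<noteq> e" by blast
  with 0 assms(4) T show ?case by auto
next
  case (Suc n)
  have "\<not> D \<subseteq> {s}" using card_mono[of "{s}" D] D by auto
  then obtain d where "d \<in> D" "d \<noteq> s" by blast
  with Suc T have "T \<sigma> s d" "chain T d (replicate (Suc (Suc n)) \<sigma>) e" by auto
  then show ?case by (metis chain.simps(2) replicate_Suc)
qed

text \<open>An invariant of the whole reachable set: when some pairs are not joined, a single
  greedily chosen element could not be steered back to the start.\<close>

lemma chain_good:
  assumes step: "\<And>\<sigma> \<tau> R. \<sigma> \<in> A \<Longrightarrow> \<tau> \<in> A \<Longrightarrow> allowed \<sigma> \<tau> \<Longrightarrow> good \<sigma> R \<Longrightarrow> good \<tau> {e. \<exists>d\<in>R. T \<sigma> d e}"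
    and "successively allowed (ss @ [\<tau>])" "set (ss @ [\<tau>]) \<subseteq> A" "good (hd (ss @ [\<tau>])) R"
  shows "good \<tau> {e. \<exists>d\<in>R. chain T d ss e}"
  using assms(2-)
proof (induction ss arbitrary: R)
  case Nil
  then show ?case by simp
next
  case (Cons \<sigma> ss)
  have "allowed \<sigma> (hd (ss @ [\<tau>]))" "successively allowed (ss @ [\<tau>])"
    using Cons.prems(1) by (auto simp: successively_Cons)
  moreover have "hd (ss @ [\<tau>]) \<in> A" using Cons.prems(2) by (cases ss) auto
  ultimately have "good (hd (ss @ [\<tau>])) {e. \<exists>d\<in>R. T \<sigma> d e}"
    using Cons.prems by (intro step) auto
  from Cons.IH[OF \<open>successively allowed (ss @ [\<tau>])\<close> _ this] Cons.prems(2)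
  have "good \<tau> {e. \<exists>x. (\<exists>d\<in>R. T \<sigma> d x) \<and> chain T x ss e}" by simp
  moreover have "{e. \<exists>x. (\<exists>d\<in>R. T \<sigma> d x) \<and> chain T x ss e} = {e. \<exists>d\<in>R. chain T d (\<sigma> # ss) e}"
    by auto
  ultimately show ?case by simp
qed

text \<open>
  Start from any \<open>s\<close> in the fibre of \<open>q\<close>. Some chain reaches \<open>p\<close>; from there on the set of
  reachable elements stays good, and a good set at \<open>q\<close> can return to \<open>s\<close>.
\<close>

lemma closed_chain_good:
  assumes cyc: "cyclically allowed ss" and A: "set ss \<subseteq> A" and ss: "ss = as @ p # bs @ [q]"
    and D: "D q \<noteq> {}"
    and greedy: "\<And>\<sigma> \<tau> s. \<sigma> \<in> A \<Longrightarrow> \<tau> \<in> A \<Longrightarrow> allowed \<sigma> \<tau> \<Longrightarrow> s \<in> D \<sigma> \<Longrightarrow> \<exists>e\<in>D \<sigma> \<inter> D \<tau>. T \<sigma> s e"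
    and step: "\<And>\<sigma> \<tau> R. \<sigma> \<in> A \<Longrightarrow> \<tau> \<in> A \<Longrightarrow> allowed \<sigma> \<tau> \<Longrightarrow> good \<sigma> R \<Longrightarrow> good \<tau> {e. \<exists>d\<in>R. T \<sigma> d e}"
    and start: "\<And>\<tau> s. \<tau> \<in> A \<Longrightarrow> allowed p \<tau> \<Longrightarrow> s \<in> D p \<Longrightarrow> good \<tau> {e. T p s e}"
    and stop: "\<And>R e. good q R \<Longrightarrow> e \<in> D q \<Longrightarrow> \<exists>d\<in>R. T q d e"
  shows "closed_chain T ss"
proof -
  let ?h = "hd (as @ [p])"
  have h: "hd ss = ?h" using ss by (cases as) auto
  have "allowed q ?h" using cyc h by (simp add: cyclically_def ss)
  moreover have "?h \<in> A" "q \<in> A" using A ss by (cases as; auto)+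
  ultimately obtain s where s: "s \<in> D q" "s \<in> D ?h" using greedy[of q ?h] D by blast
  have succ: "successively allowed (as @ p # bs @ [q])"
    using cyc by (simp add: cyclically_def ss)
  have "\<exists>d\<in>D p. chain T s as d"
  proof (cases as)
    case Nil
    then show ?thesis using s by simp
  next
    case (Cons \<sigma> us)
    have "successively allowed (\<sigma> # us @ [p])"
      using succ Cons successively_append_iff[of allowed "\<sigma> # us @ [p]" "bs @ [q]"] by simp
    then have "\<exists>e\<in>D (last (\<sigma> # us)) \<inter> D p. chain T s (\<sigma> # us) e"
      using A ss Cons s
      by (intro chain_greedy[where A = A and allowed = allowed, OF greedy]) auto
    then show ?thesis using Cons by blast
  qed
  then obtain d where d: "d \<in> D p" "chain T s as d" by blast
  have sbs: "successively allowed (bs @ [q])" and "allowed p (hd (bs @ [q]))"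
    using succ by (auto simp: successively_append_iff successively_Cons)
  moreover have "hd (bs @ [q]) \<in> A" using A ss by (cases bs) auto
  ultimately have "good (hd (bs @ [q])) {e. T p d e}" using d start by blast
  then have "good q {e. \<exists>d'\<in>{e. T p d e}. chain T d' bs e}"
    using A ss
    by (intro chain_good[where A = A and allowed = allowed and good = good and T = T, OF _ sbs])
      (erule (3) step, auto)
  from stop[OF this s(1)] obtain x y where "T p d y" "chain T y bs x" "T q x s" by blast
  with d(2) have "chain T s ss s" unfolding ss by (auto simp: chain_append)
  then show ?thesis unfolding closed_chain_def by blast
qed

section \<open>Colorings of a graph extended by a path\<close>

definition colorings :: "nat \<Rightarrow> 'a set \<Rightarrow> 'a rel \<Rightarrow> ('a \<Rightarrow> nat) set" where
  "colorings k V E = {\<phi> \<in> V \<rightarrow>\<^sub>E {1..k}. \<forall>(x, y)\<in>E. \<phi> x \<noteq> \<phi> y}"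

text \<open>A path replaces the connected subgraph. For \<open>j \<le> 2\<close>, the only case
  used, this loses nothing, and subpaths of an ear qualify directly.\<close>

definition recolor :: "nat \<Rightarrow> 'a rel \<Rightarrow> ('a \<Rightarrow> nat) \<Rightarrow> ('a \<Rightarrow> nat) \<Rightarrow> bool" where
  "recolor j E \<phi> \<psi> \<longleftrightarrow> \<phi> \<noteq> \<psi> \<and>
    (\<exists>q. distinct q \<and> length q \<le> j \<and> successively (\<lambda>x y. (x, y) \<in> E) q \<and> {v. \<phi> v \<noteq> \<psi> v} \<subseteq> set q)"

text \<open>The counterpart of \<open>recolor\<close> inside one path: all differences lie in a
  window of \<open>j\<close> positions that begins at the first of them. Equal lists are unrelated,
  as \<open>recolor\<close> demands distinct colorings.\<close>

fun list_recolor :: "nat \<Rightarrow> 'c list \<Rightarrow> 'c list \<Rightarrow> bool" where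
  "list_recolor j (c # cs) (d # ds) \<longleftrightarrow>
    (if c = d then list_recolor j cs ds else drop j (c # cs) = drop j (d # ds))"
| "list_recolor j _ _ \<longleftrightarrow> False"

text \<open>The two lists hold the colors of the neighbours of the first and of the last path vertex.\<close>

definition fibre :: "nat \<Rightarrow> nat \<Rightarrow> nat list \<times> nat list \<Rightarrow> nat list list" where
  "fibre k n = (\<lambda>(as, bs).
    filter (\<lambda>cs. successively (\<noteq>) (as @ cs @ bs)) (List.n_lists n [1..<Suc k]))"

definition hamiltonian_cycle :: "'c set \<Rightarrow> ('c \<Rightarrow> 'c \<Rightarrow> bool) \<Rightarrow> 'c list \<Rightarrow> bool" where
  "hamiltonian_cycle A R xs \<longleftrightarrow> distinct xs \<and> set xs = A \<and> 3 \<le> length xs \<and> cyclically R xs"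

definition hamiltonian_path :: "'c set \<Rightarrow> ('c \<Rightarrow> 'c \<Rightarrow> bool) \<Rightarrow> 'c \<Rightarrow> 'c \<Rightarrow> bool" where
  "hamiltonian_path A R s e \<longleftrightarrow>
    (\<exists>xs. distinct xs \<and> set xs = A \<and> successively R xs \<and> xs \<noteq> [] \<and> hd xs = s \<and> last xs = e)"

definition glue :: "'a list \<Rightarrow> ('a \<Rightarrow> nat) \<Rightarrow> nat list \<Rightarrow> 'a \<Rightarrow> nat" where
  "glue p \<phi> cs = (\<lambda>v. case map_of (zip p cs) v of Some c \<Rightarrow> c | None \<Rightarrow> \<phi> v)"

section \<open>Lifting Hamiltonian cycles along a fibration\<close>

lemma hamiltonian_pathD: "hamiltonian_path A R s e \<Longrightarrow> s \<in> A \<and> e \<in> A"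
  unfolding hamiltonian_path_def by auto

lemma chain_hamiltonian_path:
  assumes "xs \<noteq> []" "distinct xs" "successively R xs" "chain T s xs e"
    and path: "\<And>x c d. x \<in> set xs \<Longrightarrow> T x c d \<Longrightarrow> hamiltonian_path (F x) S c d"
    and inner: "\<And>x c d. x \<in> set xs \<Longrightarrow> c \<in> F x \<Longrightarrow> d \<in> F x \<Longrightarrow> S c d \<Longrightarrow> R' (g x c) (g x d)"
    and cross: "\<And>x y c. x \<in> set xs \<Longrightarrow> y \<in> set xs \<Longrightarrow> R x y \<Longrightarrow> c \<in> F x \<Longrightarrow> c \<in> F y \<Longrightarrow> R' (g x c) (g y c)"
    and inj: "inj_on (\<lambda>(x, c). g x c) (Sigma (set xs) F)"
  shows "hamiltonian_path ((\<lambda>(x, c). g x c) ` Sigma (set xs) F) R' (g (hd xs) s) (g (last xs) e)"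
  using assms
proof (induction xs arbitrary: s)
  case Nil
  then show ?case by simp
next
  case (Cons x xs)
  from Cons.prems(4) obtain d where d: "T x s d" "chain T d xs e" by auto
  from Cons.prems(5)[of x s d] d(1) obtain P where P: "distinct P" "set P = F x" "successively S P"
    "P \<noteq> []" "hd P = s" "last P = d"
    unfolding hamiltonian_path_def by auto
  have gP: "distinct (map (g x) P)" "set (map (g x) P) = (\<lambda>(x, c). g x c) ` Sigma {x} F"
    "successively R' (map (g x) P)" "map (g x) P \<noteq> []"
    "hd (map (g x) P) = g x s" "last (map (g x) P) = g x d"
  proof -
    show "distinct (map (g x) P)"
      using Cons.prems(8) P(1,2) by (auto simp: distinct_map inj_on_def)
    show "successively R' (map (g x) P)"
      unfolding successively_map
      by (rule successively_mono[OF P(3)]) (use Cons.prems(6)[of x] P(2) in auto)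
  qed (use P in \<open>auto simp: hd_map last_map\<close>)
  show ?case
  proof (cases "xs = []")
    case True
    then show ?thesis using gP d(2) unfolding hamiltonian_path_def
      by (intro exI[of _ "map (g x) P"]) auto
  next
    case False
    have "successively R xs" "R x (hd xs)"
      using Cons.prems(3) False by (auto simp: successively_Cons)
    have "hamiltonian_path ((\<lambda>(x, c). g x c) ` Sigma (set xs) F) R' (g (hd xs) d) (g (last xs) e)"
      by (rule Cons.IH) (use Cons.prems False d(2) \<open>successively R xs\<close> in
        \<open>auto intro: inj_on_subset[OF Cons.prems(8)]\<close>)
    then obtain Q where Q: "distinct Q" "set Q = (\<lambda>(x, c). g x c) ` Sigma (set xs) F" "successively R' Q"
      "Q \<noteq> []" "hd Q = g (hd xs) d" "last Q = g (last xs) e"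
      unfolding hamiltonian_path_def by auto
    have "set (map (g x) P) \<inter> set Q = {}"
      unfolding gP(2) Q(2) using Cons.prems(2,8)
      by (subst inj_on_image_Int[OF Cons.prems(8), symmetric]) auto
    moreover have "d \<in> F (hd xs)"
      using d(2) False hamiltonian_pathD[OF Cons.prems(5)] by (cases xs) auto
    then have "R' (g x d) (g (hd xs) d)"
      using Cons.prems(7)[of x "hd xs" d] \<open>R x (hd xs)\<close> False last_in_set[OF P(4)] P(2,6) by auto
    moreover have "set (map (g x) P) \<union> set Q = (\<lambda>(x, c). g x c) ` Sigma (set (x # xs)) F"
      unfolding gP(2) Q(2) by auto
    ultimately show ?thesis using gP Q False unfolding hamiltonian_path_def
      by (intro exI[of _ "map (g x) P @ Q"]) (auto simp: successively_append_iff)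
  qed
qed

lemma hamiltonian_cycle_fibration:
  assumes ham: "hamiltonian_cycle A R xs" and chain: "closed_chain T xs"
    and path: "\<And>x c d. x \<in> A \<Longrightarrow> T x c d \<Longrightarrow> hamiltonian_path (F x) S c d"
    and inner: "\<And>x c d. x \<in> A \<Longrightarrow> c \<in> F x \<Longrightarrow> d \<in> F x \<Longrightarrow> S c d \<Longrightarrow> R' (g x c) (g x d)"
    and cross: "\<And>x y c. x \<in> A \<Longrightarrow> y \<in> A \<Longrightarrow> R x y \<Longrightarrow> c \<in> F x \<Longrightarrow> c \<in> F y \<Longrightarrow> R' (g x c) (g y c)"
    and inj: "inj_on (\<lambda>(x, c). g x c) (Sigma A F)"
  shows "\<exists>ys. hamiltonian_cycle ((\<lambda>(x, c). g x c) ` Sigma A F) R' ys"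
proof -
  from ham have xs: "distinct xs" "set xs = A" "3 \<le> length xs" "successively R xs" "R (last xs) (hd xs)"
    "xs \<noteq> []"
    unfolding hamiltonian_cycle_def cyclically_def by auto
  from chain obtain s where s: "chain T s xs s" unfolding closed_chain_def by blast
  have ne: "\<exists>c. c \<in> F x" if "x \<in> A" for x
  proof -
    have "\<exists>c d. T x c d" using s that xs(2)
      by (metis chain.simps(2) chain_append in_set_conv_decomp)
    then show ?thesis using path[OF that] hamiltonian_pathD by metis
  qed
  have "hamiltonian_path ((\<lambda>(x, c). g x c) ` Sigma (set xs) F) R' (g (hd xs) s) (g (last xs) s)"
    by (rule chain_hamiltonian_path[where T = T and R = R and S = S]) (use xs s assms in auto)
  then obtain ys where ys: "distinct ys" "set ys = (\<lambda>(x, c). g x c) ` Sigma A F" "successively R' ys"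
    "ys \<noteq> []" "hd ys = g (hd xs) s" "last ys = g (last xs) s"
    unfolding hamiltonian_path_def xs(2) by auto
  have "s \<in> F (hd xs)" using s xs path hamiltonian_pathD by (cases xs) fastforce+
  moreover have "s \<in> F (last xs)"
  proof -
    obtain us x where "xs = us @ [x]" using xs(6) by (cases xs rule: rev_cases) auto
    then show ?thesis using s xs(2) path[THEN hamiltonian_pathD] by (auto simp: chain_append)
  qed
  ultimately have "R' (last ys) (hd ys)" unfolding ys
    using cross[of "last xs" "hd xs" s] xs by auto
  moreover have "3 \<le> length ys"
  proof -
    \<comment> \<open>A choice of one element in each fibre embeds the base cycle, so
      \<open>ys\<close> is at least as long as \<open>xs\<close>.\<close>
    define f where "f x = (SOME c. c \<in> F x)" for x
    have f: "f x \<in> F x" if "x \<in> A" for x unfolding f_def using someI_ex[OF ne[OF that]] .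
    have "inj_on (\<lambda>x. g x (f x)) A"
      using inj f unfolding inj_on_def by (auto simp: Sigma_def) blast
    then have "card A \<le> card (set ys)"
      by (rule card_inj_on_le) (use f in \<open>auto simp: ys(2)[symmetric]\<close>, auto simp: ys(2))
    then show ?thesis using xs distinct_card[of xs] distinct_card[OF ys(1)] by simp
  qed
  ultimately show ?thesis using ys unfolding hamiltonian_cycle_def cyclically_def by blast
qed

section \<open>Colorings of a path extension as pairs of a base coloring and a fibre element\<close>

lemma path_arcs_simps [simp]:
  "path_arcs [] = {}" "path_arcs [x] = {}"
  "path_arcs (x # y # q) = {(x, y), (y, x)} \<union> path_arcs (y # q)"
  by (auto simp: path_arcs_def)

lemma path_arcs_subset: "path_arcs q \<subseteq> set q \<times> set q"
  by (induction q rule: induct_list012) auto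

lemma proper_path_iff: "(\<forall>(x, y)\<in>path_arcs q. \<psi> x \<noteq> \<psi> y) \<longleftrightarrow> successively (\<noteq>) (map \<psi> q)"
  by (induction q rule: induct_list012) auto

lemma successively_path_arcs: "path_arcs q \<subseteq> E \<Longrightarrow> successively (\<lambda>x y. (x, y) \<in> E) q"
  by (induction q rule: induct_list012) auto

lemma set_fibre:
  "set (fibre k n (as, bs)) =
    {cs. length cs = n \<and> set cs \<subseteq> {1..k} \<and> successively (\<noteq>) (as @ cs @ bs)}"
  by (auto simp: fibre_def set_n_lists)

lemma glue_outside: "length cs = length p \<Longrightarrow> v \<notin> set p \<Longrightarrow> glue p \<phi> cs v = \<phi> v"
  by (auto simp: glue_def split: option.splits dest: map_of_SomeD set_zip_leftD)

lemma glue_nth: "distinct p \<Longrightarrow> length cs = length p \<Longrightarrow> i < length p \<Longrightarrow> glue p \<phi> cs (p ! i) = cs ! i"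
  by (simp add: glue_def map_of_zip_nth)

lemma map_glue: "distinct p \<Longrightarrow> length cs = length p \<Longrightarrow> map (glue p \<phi> cs) p = cs"
  by (intro nth_equalityI) (auto simp: glue_nth)

lemma list_recolor_window:
  "list_recolor j cs ds \<Longrightarrow> length cs = length ds \<Longrightarrow>
    \<exists>i<length cs. take i cs = take i ds \<and> drop (i + j) cs = drop (i + j) ds \<and> cs ! i \<noteq> ds ! i"
proof (induction j cs ds rule: list_recolor.induct)
  case (1 j c cs d ds)
  show ?case
  proof (cases "c = d")
    case True
    with 1 obtain i where "i < length cs" "take i cs = take i ds" "drop (i + j) cs = drop (i + j) ds"
      "cs ! i \<noteq> ds ! i" by auto
    with True show ?thesis by (intro exI[of _ "Suc i"]) auto
  next
    case False
    with 1 show ?thesis by (intro exI[of _ 0]) auto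
  qed
qed auto

text \<open>At most one attachment vertex at either end: this treats isolated vertices, pendant
  paths and ears alike, and \<open>us = ws\<close> gives a loop.\<close>

locale path_extension =
  fixes V :: "'a set" and E :: "'a rel" and us p ws :: "'a list"
  assumes E: "E \<subseteq> V \<times> V" and us: "set us \<subseteq> V" "length us \<le> 1" and ws: "set ws \<subseteq> V" "length ws \<le> 1"
    and p: "distinct p" "p \<noteq> []" "set p \<inter> V = {}"
begin

abbreviation "V' \<equiv> V \<union> set p"
abbreviation "E' \<equiv> E \<union> path_arcs (us @ p @ ws)"

definition state :: "('a \<Rightarrow> nat) \<Rightarrow> nat list \<times> nat list" where
  "state \<phi> = (map \<phi> us, map \<phi> ws)"

abbreviation "Fib k \<phi> \<equiv> set (fibre k (length p) (state \<phi>))"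

lemma fibreD: "cs \<in> Fib k \<phi> \<Longrightarrow> length cs = length p \<and> set cs \<subseteq> {1..k}"
  by (auto simp: state_def set_fibre)

lemma glue_old: "length cs = length p \<Longrightarrow> v \<in> V \<Longrightarrow> glue p \<phi> cs v = \<phi> v"
  using p(3) by (intro glue_outside) auto

lemma map_glue_old: "length cs = length p \<Longrightarrow> set q \<subseteq> V \<Longrightarrow> map (glue p \<phi> cs) q = map \<phi> q"
  by (auto simp: glue_old subset_iff)

lemma E'_subset: "E' \<subseteq> V' \<times> V'"
  using E us ws path_arcs_subset[of "us @ p @ ws"] by fastforce

lemma colorings_glue:
  assumes "\<phi> \<in> colorings k V E" and cs: "cs \<in> Fib k \<phi>"
  shows "glue p \<phi> cs \<in> colorings k V' E'"
proof -
  let ?\<psi> = "glue p \<phi> cs"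
  have len: "length cs = length p" and range: "set cs \<subseteq> {1..k}" using fibreD[OF cs] by auto
  have "?\<psi> v \<in> {1..k}" if v: "v \<in> V'" for v
  proof (cases "v \<in> V")
    case True
    then show ?thesis using assms(1) by (auto simp: glue_old[OF len] colorings_def)
  next
    case False
    then obtain i where "i < length p" "v = p ! i" using v by (auto simp: in_set_conv_nth)
    then have "?\<psi> v = cs ! i" "cs ! i \<in> set cs" using len p(1) by (simp_all add: glue_nth)
    then show ?thesis using range by (metis subsetD)
  qed
  moreover have "?\<psi> v = undefined" if "v \<notin> V'" for v
  proof -
    have "\<phi> \<in> V \<rightarrow>\<^sub>E {1..k}" using assms(1) by (simp add: colorings_def)
    from PiE_arb[OF this] show ?thesis using that by (simp add: glue_outside[OF len])
  qed
  moreover have "\<forall>(x, y)\<in>E. ?\<psi> x \<noteq> ?\<psi> y"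
    using assms(1) E by (auto simp: glue_old[OF len] colorings_def subset_iff)
  moreover have "\<forall>(x, y)\<in>path_arcs (us @ p @ ws). ?\<psi> x \<noteq> ?\<psi> y"
    unfolding proper_path_iff using cs us ws p
    by (simp add: map_glue_old[OF len] map_glue[OF p(1) len] state_def set_fibre)
  ultimately show ?thesis unfolding colorings_def by (auto intro!: PiE_I)
qed

lemma colorings_extension:
  "colorings k V' E' = (\<lambda>(\<phi>, cs). glue p \<phi> cs) ` Sigma (colorings k V E) (Fib k)"
proof (intro equalityI subsetI)
  fix \<psi> assume \<psi>: "\<psi> \<in> colorings k V' E'"
  let ?\<phi> = "restrict \<psi> V" and ?cs = "map \<psi> p"
  have PiE: "\<psi> \<in> V' \<rightarrow>\<^sub>E {1..k}" and proper: "\<forall>(x, y)\<in>E'. \<psi> x \<noteq> \<psi> y"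
    using \<psi> unfolding colorings_def by blast+
  have "\<forall>(x, y)\<in>E. ?\<phi> x \<noteq> ?\<phi> y"
  proof clarify
    fix x y assume "(x, y) \<in> E" "?\<phi> x = ?\<phi> y"
    moreover from this E have "x \<in> V" "y \<in> V" by auto
    ultimately show False using proper by auto
  qed
  moreover have "?\<phi> \<in> V \<rightarrow>\<^sub>E {1..k}" using PiE by auto
  ultimately have "?\<phi> \<in> colorings k V E" by (simp add: colorings_def)
  moreover have "state ?\<phi> = (map \<psi> us, map \<psi> ws)" using us ws by (auto simp: state_def)
  moreover have "successively (\<noteq>) (map \<psi> (us @ p @ ws))"
    using proper unfolding proper_path_iff[symmetric] by blast
  moreover have "set ?cs \<subseteq> {1..k}" using PiE by auto
  ultimately have "(?\<phi>, ?cs) \<in> Sigma (colorings k V E) (Fib k)"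
    by (auto simp: set_fibre)
  moreover have "glue p ?\<phi> ?cs = \<psi>"
  proof
    fix v show "glue p ?\<phi> ?cs v = \<psi> v"
      using PiE_arb[OF PiE, of v] by (auto simp: glue_def map_of_zip_map)
  qed
  ultimately show "\<psi> \<in> (\<lambda>(\<phi>, cs). glue p \<phi> cs) ` Sigma (colorings k V E) (Fib k)" by force
qed (auto intro: colorings_glue)

lemma inj_on_glue: "inj_on (\<lambda>(\<phi>, cs). glue p \<phi> cs) (Sigma (colorings k V E) (Fib k))"
proof (rule inj_onI, clarify, rule conjI)
  fix \<phi> cs \<phi>' cs'
  assume *: "\<phi> \<in> colorings k V E" "cs \<in> Fib k \<phi>" "\<phi>' \<in> colorings k V E" "cs' \<in> Fib k \<phi>'"
    "glue p \<phi> cs = glue p \<phi>' cs'"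
  note len = fibreD[OF *(2)] fibreD[OF *(4)]
  show "cs = cs'" using map_glue[OF p(1), of cs \<phi>] map_glue[OF p(1), of cs' \<phi>'] len *(5) by simp
  show "\<phi> = \<phi>'"
  proof (rule extensionalityI[of _ V])
    show "\<phi> v = \<phi>' v" if "v \<in> V" for v
      using that len glue_old[of cs v \<phi>] glue_old[of cs' v \<phi>'] *(5) by simp
  qed (use * in \<open>auto simp: colorings_def PiE_def\<close>)
qed

lemma recolor_fibre:
  assumes "cs \<in> Fib k \<phi>" "ds \<in> Fib k \<phi>" "list_recolor j cs ds"
  shows "recolor j E' (glue p \<phi> cs) (glue p \<phi> ds)"
proof -
  have len: "length cs = length p" "length ds = length p" using assms fibreD by auto
  obtain i where i: "i < length p" "take i cs = take i ds" "drop (i + j) cs = drop (i + j) ds"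
    "cs ! i \<noteq> ds ! i" using list_recolor_window[OF assms(3)] len by auto
  \<comment> \<open>\<open>i\<close> is the position of the first difference. Near the end of
    \<open>p\<close> the window is cut short, so its length is only bounded by
    \<open>j\<close>.\<close>
  define q where "q = take j (drop i p)"
  have split: "p = take i p @ q @ drop (i + j) p"
    unfolding q_def by (metis add.commute append_take_drop_id drop_drop)
  have "successively (\<lambda>x y. (x, y) \<in> E') (us @ p @ ws)" by (rule successively_path_arcs) auto
  then have "successively (\<lambda>x y. (x, y) \<in> E') p"
    unfolding successively_append_iff by blast
  then have "successively (\<lambda>x y. (x, y) \<in> E') (take i p @ q @ drop (i + j) p)"
    unfolding split[symmetric] .
  then have "successively (\<lambda>x y. (x, y) \<in> E') q"
    unfolding successively_append_iff by blast
  moreover have "glue p \<phi> cs v = glue p \<phi> ds v" if "v \<notin> set q" for v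
  proof (cases "v \<in> set p")
    case True
    then obtain m where m: "m < length p" "v = p ! m" by (auto simp: in_set_conv_nth)
    have "m < i \<or> i + j \<le> m"
    proof (rule ccontr)
      assume "\<not> ?thesis"
      then have "q ! (m - i) = v" "m - i < length q" using m unfolding q_def by auto
      then show False using that by auto
    qed
    then have "cs ! m = ds ! m"
    proof
      assume "m < i"
      then show ?thesis using arg_cong[OF i(2), of "\<lambda>xs. xs ! m"] by simp
    next
      assume "i + j \<le> m"
      then show ?thesis using arg_cong[OF i(3), of "\<lambda>xs. xs ! (m - (i + j))"] m len by simp
    qed
    then show ?thesis using m len p(1) by (simp add: glue_nth)
  qed (simp add: glue_outside len)
  moreover have "glue p \<phi> cs (p ! i) \<noteq> glue p \<phi> ds (p ! i)" using i len p(1) by (simp add: glue_nth)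
  ultimately show ?thesis unfolding recolor_def
    by (intro conjI exI[of _ q]) (auto simp: q_def p(1))
qed

lemma recolor_base:
  assumes "\<phi> \<in> colorings k V E" "\<psi> \<in> colorings k V E" "recolor j E \<phi> \<psi>" "cs \<in> Fib k \<phi>" "cs \<in> Fib k \<psi>"
  shows "recolor j E' (glue p \<phi> cs) (glue p \<psi> cs)"
proof -
  have len: "length cs = length p" using assms fibreD by auto
  obtain q where q: "distinct q" "length q \<le> j" "successively (\<lambda>x y. (x, y) \<in> E) q"
    "{v. \<phi> v \<noteq> \<psi> v} \<subseteq> set q" and "\<phi> \<noteq> \<psi>"
    using assms(3) unfolding recolor_def by auto
  have "\<exists>v\<in>V. \<phi> v \<noteq> \<psi> v"
    using assms(1,2) \<open>\<phi> \<noteq> \<psi>\<close> by (metis (no_types, lifting) PiE_ext colorings_def mem_Collect_eq)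
  then have "glue p \<phi> cs \<noteq> glue p \<psi> cs" using glue_old[OF len] by metis
  moreover have "successively (\<lambda>x y. (x, y) \<in> E') q"
    by (rule successively_mono[OF q(3)]) auto
  moreover have "{v. glue p \<phi> cs v \<noteq> glue p \<psi> cs v} \<subseteq> set q"
    using q(4) by (auto simp: glue_def split: option.splits)
  ultimately show ?thesis using q unfolding recolor_def by blast
qed

text \<open>\<open>T\<close> sees a coloring only through its state, so finitely many fibres have to
  be inspected, whatever \<open>V\<close> and \<open>E\<close> are.\<close>

lemma hamiltonian_cycle_extension:
  assumes "hamiltonian_cycle (colorings k V E) (recolor j E) xs"
    and "closed_chain T (map state xs)"
    and "\<And>\<phi> s e. \<phi> \<in> colorings k V E \<Longrightarrow> T (state \<phi>) s e \<Longrightarrow>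
      hamiltonian_path (Fib k \<phi>) (list_recolor j) s e"
  shows "\<exists>ys. hamiltonian_cycle (colorings k V' E') (recolor j E') ys"
proof -
  have "chain (\<lambda>\<phi>. T (state \<phi>)) s xs e \<longleftrightarrow> chain T s (map state xs) e" for s e
    by (induction xs arbitrary: s) auto
  then have "closed_chain (\<lambda>\<phi>. T (state \<phi>)) xs" using assms(2) by (simp add: closed_chain_def)
  then show ?thesis unfolding colorings_extension
    by (rule hamiltonian_cycle_fibration[where S = "list_recolor j", OF assms(1)])
      (use assms(3) recolor_fibre recolor_base inj_on_glue in auto)
qed

text \<open>A base path lifts step by step: move within the current fibre to an element shared with
  the next one, then change the base coloring underneath it.\<close>

lemma colorings_connected_extension:
  assumes conn: "\<And>\<phi> \<psi>. \<phi> \<in> colorings k V E \<Longrightarrow> \<psi> \<in> colorings k V E \<Longrightarrow>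
      (\<lambda>\<phi> \<psi>. \<phi> \<in> colorings k V E \<and> \<psi> \<in> colorings k V E \<and> recolor j E \<phi> \<psi>)\<^sup>*\<^sup>* \<phi> \<psi>"
    and fib: "\<And>\<phi> cs ds. \<phi> \<in> colorings k V E \<Longrightarrow> cs \<in> Fib k \<phi> \<Longrightarrow> ds \<in> Fib k \<phi> \<Longrightarrow>
      (\<lambda>cs ds. cs \<in> Fib k \<phi> \<and> ds \<in> Fib k \<phi> \<and> list_recolor j cs ds)\<^sup>*\<^sup>* cs ds"
    and meet: "\<And>\<phi> \<psi>. \<phi> \<in> colorings k V E \<Longrightarrow> \<psi> \<in> colorings k V E \<Longrightarrow> recolor j E \<phi> \<psi> \<Longrightarrow>
      Fib k \<phi> \<inter> Fib k \<psi> \<noteq> {}"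
    and "\<phi> \<in> colorings k V' E'" "\<psi> \<in> colorings k V' E'"
  shows "(\<lambda>\<phi> \<psi>. \<phi> \<in> colorings k V' E' \<and> \<psi> \<in> colorings k V' E' \<and> recolor j E' \<phi> \<psi>)\<^sup>*\<^sup>* \<phi> \<psi>"
proof -
  let ?R = "\<lambda>\<phi> \<psi>. \<phi> \<in> colorings k V E \<and> \<psi> \<in> colorings k V E \<and> recolor j E \<phi> \<psi>"
  let ?R' = "\<lambda>\<phi> \<psi>. \<phi> \<in> colorings k V' E' \<and> \<psi> \<in> colorings k V' E' \<and> recolor j E' \<phi> \<psi>"
  have inner: "?R'\<^sup>*\<^sup>* (glue p \<phi> cs) (glue p \<phi> ds)"
    if "\<phi> \<in> colorings k V E" "cs \<in> Fib k \<phi>" "ds \<in> Fib k \<phi>" for \<phi> cs ds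
    using fib[OF that]
  proof (induction rule: rtranclp_induct)
    case (step ds es)
    then have "?R' (glue p \<phi> ds) (glue p \<phi> es)"
      using that(1) colorings_glue recolor_fibre by blast
    from rtranclp.rtrancl_into_rtrancl[of ?R', OF step.IH this] show ?case .
  qed auto
  have outer: "\<forall>ds\<in>Fib k \<psi>. ?R'\<^sup>*\<^sup>* (glue p \<phi> cs) (glue p \<psi> ds)"
    if "?R\<^sup>*\<^sup>* \<phi> \<psi>" "\<phi> \<in> colorings k V E" "cs \<in> Fib k \<phi>" for \<phi> \<psi> cs
    using that
  proof (induction rule: rtranclp_induct)
    case base
    then show ?case using inner by blast
  next
    case (step \<psi> \<upsilon>)
    then obtain es where es: "es \<in> Fib k \<psi>" "es \<in> Fib k \<upsilon>" using meet by blast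
    then have "?R' (glue p \<psi> es) (glue p \<upsilon> es)"
      using step.hyps colorings_glue recolor_base by blast
    moreover have "?R'\<^sup>*\<^sup>* (glue p \<phi> cs) (glue p \<psi> es)" using step.IH step.prems es by blast
    ultimately have "?R'\<^sup>*\<^sup>* (glue p \<phi> cs) (glue p \<upsilon> es)"
      using rtranclp.rtrancl_into_rtrancl[of ?R'] by blast
    then show ?case using inner[of \<upsilon> es] step.hyps es rtranclp_trans[of ?R'] by blast
  qed
  from assms(4) obtain \<phi>\<^sub>0 cs where \<phi>: "\<phi> = glue p \<phi>\<^sub>0 cs" "\<phi>\<^sub>0 \<in> colorings k V E" "cs \<in> Fib k \<phi>\<^sub>0"
    unfolding colorings_extension by auto
  from assms(5) obtain \<psi>\<^sub>0 ds where \<psi>: "\<psi> = glue p \<psi>\<^sub>0 ds" "\<psi>\<^sub>0 \<in> colorings k V E" "ds \<in> Fib k \<psi>\<^sub>0"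
    unfolding colorings_extension by auto
  show ?thesis using outer[OF conn[OF \<phi>(2) \<psi>(2)] \<phi>(2,3)] \<psi>(1,3) \<phi>(1) by blast
qed

end

section \<open>Fibres of short paths\<close>

text \<open>
  \<open>R\<close> holds the vertices still to be visited, \<open>C\<close> the candidates for the next one. The recursion over
  \<open>C\<close> and the nested conditionals replace bounded quantifiers because \<open>code_simp\<close> evaluates \<open>if\<close>
  lazily, but \<open>\<and>\<close>, \<open>\<or>\<close> and the bodies of abstractions eagerly.
\<close>

fun path_search :: "nat \<Rightarrow> nat \<Rightarrow> 'c list \<Rightarrow> 'c list \<Rightarrow> 'c list list \<Rightarrow> 'c list list \<Rightarrow> bool" where
  "path_search j 0 s e R C = (if R = [] then s = e else False)"
| "path_search j (Suc n) s e R [] = False"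
| "path_search j (Suc n) s e R (x # C) =
    (if list_recolor j s x
     then if path_search j n x e (remove1 x R) (remove1 x R) then True else path_search j (Suc n) s e R C
     else path_search j (Suc n) s e R C)"

fun all_joined :: "nat \<Rightarrow> 'c list list \<Rightarrow> ('c list \<times> 'c list) list \<Rightarrow> bool" where
  "all_joined j F [] = True"
| "all_joined j F ((s, e) # ps) =
    (if path_search j (length F - 1) s e (remove1 s F) (remove1 s F) then all_joined j F ps else False)"

type_synonym state = "nat list \<times> nat list"

definition links_joined :: "nat \<Rightarrow> nat \<Rightarrow> nat \<Rightarrow> (state \<Rightarrow> nat list \<Rightarrow> nat list \<Rightarrow> bool) \<Rightarrow> state \<Rightarrow> bool" where
  "links_joined k j n link \<sigma> =
    all_joined j (fibre k n \<sigma>) (filter (\<lambda>(s, e). link \<sigma> s e) (List.product (fibre k n \<sigma>) (fibre k n \<sigma>)))"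

fun hits :: "(state \<Rightarrow> nat list \<Rightarrow> nat list \<Rightarrow> bool) \<Rightarrow> state \<Rightarrow> nat list list \<Rightarrow> nat list \<Rightarrow> bool" where
  "hits link \<sigma> [] e = False"
| "hits link \<sigma> (d # R) e = (if link \<sigma> d e then True else hits link \<sigma> R e)"

fun missed :: "(state \<Rightarrow> nat list \<Rightarrow> nat list \<Rightarrow> bool) \<Rightarrow> state \<Rightarrow> nat list list \<Rightarrow> nat list list \<Rightarrow> nat list list" where
  "missed link \<sigma> R [] = []"
| "missed link \<sigma> R (e # F) = (if hits link \<sigma> R e then missed link \<sigma> R F else e # missed link \<sigma> R F)"

text \<open>
  From the elements of \<open>R\<close>, Hamiltonian paths of the fibre lead to all of its elements, except for at
  most one if the state is weak.
\<close>

definition reaches :: "nat \<Rightarrow> nat \<Rightarrow> (state \<Rightarrow> nat list \<Rightarrow> nat list \<Rightarrow> bool) \<Rightarrow> (state \<Rightarrow> bool) \<Rightarrow> state \<Rightarrow> nat list list \<Rightarrow> bool" where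
  "reaches k n link weak \<tau> R \<longleftrightarrow>
    length (missed link \<tau> (filter (List.member (fibre k n \<tau>)) R) (fibre k n \<tau>)) \<le> (if weak \<tau> then 1 else 0)"

definition greedy_ok where
  "greedy_ok k n link \<sigma> \<tau> s \<longleftrightarrow> filter (List.member (fibre k n \<tau>)) (filter (link \<sigma> s) (fibre k n \<sigma>)) \<noteq> []"

definition start_ok where
  "start_ok k n link weak \<sigma> \<tau> s \<longleftrightarrow> reaches k n link weak \<tau> (filter (link \<sigma> s) (fibre k n \<sigma>))"

text \<open>A covering set leads to the whole fibre of \<open>\<sigma>\<close>, except for one
  element if \<open>\<sigma>\<close> is weak. Which one is unknown, so \<open>m\<close> is made to
  run through the fibre.\<close>

definition step_ok where
  "step_ok k n link weak \<sigma> \<tau> m \<longleftrightarrow>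
    reaches k n link weak \<tau> (if weak \<sigma> then removeAll m (fibre k n \<sigma>) else fibre k n \<sigma>)"

text \<open>Executable forms of the hypotheses \<open>greedy\<close>, \<open>step\<close> and
  \<open>start\<close> of \<open>closed_chain_good\<close>. Special states are those at which a
  single element is enough to start a good set.\<close>

definition transition_ok where
  "transition_ok k n link weak special = (\<lambda>(\<sigma>, \<tau>).
    list_all (greedy_ok k n link \<sigma> \<tau>) (fibre k n \<sigma>) \<and>
    list_all (step_ok k n link weak \<sigma> \<tau>) (fibre k n \<sigma>) \<and>
    (if special \<sigma> then list_all (start_ok k n link weak \<sigma> \<tau>) (fibre k n \<sigma>) else True))"

definition one_end_fixed :: "state \<times> state \<Rightarrow> bool" where
  "one_end_fixed = (\<lambda>((as, bs), (as', bs')). as = as' \<or> bs = bs')"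

definition ear_states :: "nat \<Rightarrow> state list" where
  "ear_states k = List.product (map (\<lambda>a. [a]) [1..<Suc k]) (map (\<lambda>a. [a]) [1..<Suc k])"

definition ear_transitions where
  "ear_transitions k = filter one_end_fixed (List.product (ear_states k) (ear_states k))"

definition ends_equal :: "state \<Rightarrow> bool" where "ends_equal \<sigma> \<longleftrightarrow> fst \<sigma> = snd \<sigma>"
definition ends_differ :: "state \<Rightarrow> bool" where "ends_differ \<sigma> \<longleftrightarrow> fst \<sigma> \<noteq> snd \<sigma>"
definition never :: "state \<Rightarrow> bool" where "never \<sigma> \<longleftrightarrow> False"

text \<open>
  Two internal vertices and four colors: if the ends have equal colors, the fibre is a 6-cycle. If
  they have different colors, it is a 6-cycle with a hub adjacent to four of its vertices, and only
  two pairs of distinct vertices are not joined by a Hamiltonian path; these are the opposite pairs.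
\<close>

definition opposite :: "state \<Rightarrow> nat list \<Rightarrow> nat list \<Rightarrow> bool" where
  "opposite \<sigma> s e \<longleftrightarrow> hd s = hd (snd \<sigma>) \<and> last e = hd (fst \<sigma>) \<and>
    distinct [hd (fst \<sigma>), hd (snd \<sigma>), last s, hd e]"

text \<open>A Hamiltonian path of a 6-cycle joins two neighbours, hence
  \<open>list_recolor 1\<close> at equal ends.\<close>

definition link2 :: "state \<Rightarrow> nat list \<Rightarrow> nat list \<Rightarrow> bool" where
  "link2 \<sigma> s e = (if fst \<sigma> = snd \<sigma> then list_recolor 1 s e
     else s \<noteq> e \<and> \<not> opposite \<sigma> s e \<and> \<not> opposite \<sigma> e s)"

text \<open>
  Three internal vertices and three colors: exactly two elements of the fibre are central, and they
  form the only pair that is not joined by a Hamiltonian path.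
\<close>

definition central :: "state \<Rightarrow> nat list \<Rightarrow> bool" where
  "central \<sigma> s \<longleftrightarrow> distinct s \<and> (hd (tl s) = hd (fst \<sigma>) \<or> hd (tl s) = hd (snd \<sigma>))"

definition link3 :: "state \<Rightarrow> nat list \<Rightarrow> nat list \<Rightarrow> bool" where
  "link3 \<sigma> s e \<longleftrightarrow> s \<noteq> e \<and> \<not> (central \<sigma> s \<and> central \<sigma> e)"

text \<open>
  Four internal vertices and three colors: a part of the fibre, kept small to shorten the search, that
  still has two elements in common with the corresponding part for every possible next state.
\<close>

definition alternating_or_closed :: "nat list \<Rightarrow> bool" where
  "alternating_or_closed s \<longleftrightarrow> hd s = last s \<or> (s ! 0 = s ! 2 \<and> s ! 1 = s ! 3)"

text \<open>\<open>P\<close> restricts only the ends; the Hamiltonian path between them still runs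
  through the full fibre.\<close>

definition distinct_link where
  "distinct_link P \<sigma> s e \<longleftrightarrow> s \<noteq> e \<and> P s \<and> P (e :: nat list)"

definition any_list :: "nat list \<Rightarrow> bool" where "any_list s \<longleftrightarrow> True"

text \<open>For a loop with three internal vertices this drops just the two central lists of the
  fibre, so all remaining pairs are joined.\<close>

definition ends_match :: "nat list \<Rightarrow> bool" where "ends_match s \<longleftrightarrow> hd s = last s"

definition meets :: "nat \<Rightarrow> nat \<Rightarrow> nat \<Rightarrow> (nat list \<Rightarrow> bool) \<Rightarrow> state \<times> state \<Rightarrow> bool" where
  "meets m k n P = (\<lambda>(\<sigma>, \<tau>).
    m \<le> length (filter (List.member (filter P (fibre k n \<tau>))) (filter P (fibre k n \<sigma>))))"

definition pendant_states :: "nat \<Rightarrow> state list" where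
  "pendant_states k = map (\<lambda>a. ([a], [])) [1..<Suc k]"

definition loop_states :: "nat \<Rightarrow> state list" where
  "loop_states k = map (\<lambda>a. ([a], [a])) [1..<Suc k]"

section \<open>Exhaustive examination of the short fibres\<close>

lemma isolated_links:
  "links_joined 3 2 1 (distinct_link any_list) ([], [])"
  "links_joined 4 1 1 (distinct_link any_list) ([], [])"
  by code_simp+

lemma pendant_links:
  "list_all (links_joined 3 2 1 (distinct_link any_list)) (pendant_states 3)"
  "list_all (links_joined 4 1 1 (distinct_link any_list)) (pendant_states 4)"
  "list_all (links_joined 3 2 2 (distinct_link any_list)) (pendant_states 3)"
  by code_simp+

lemma pendant_meets:
  "list_all (meets 1 3 1 any_list) (List.product (pendant_states 3) (pendant_states 3))"
  "list_all (meets 2 4 1 any_list) (List.product (pendant_states 4) (pendant_states 4))"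
  "list_all (meets 2 3 2 any_list) (List.product (pendant_states 3) (pendant_states 3))"
  by code_simp+

lemma loop_links:
  "list_all (links_joined 3 2 3 (distinct_link ends_match)) (loop_states 3)"
  by code_simp

lemma loop_meets:
  "list_all (meets 2 3 3 ends_match) (List.product (loop_states 3) (loop_states 3))"
  "list_all (meets 2 3 4 alternating_or_closed) (List.product (loop_states 3) (loop_states 3))"
  by code_simp+

lemma ear_links:
  "list_all (links_joined 3 2 2 (distinct_link any_list)) (ear_states 3)"
  by code_simp

lemma ear_meets:
  "list_all (meets 1 3 2 any_list) (ear_transitions 3)"
  "list_all (meets 2 3 4 alternating_or_closed) (ear_transitions 3)"
  by code_simp+

lemma links2: "list_all (links_joined 4 1 2 link2) (ear_states 4)"
  by code_simp

lemma links3: "list_all (links_joined 3 2 3 link3) (ear_states 3)"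
  by code_simp

lemma links4: "list_all (links_joined 3 2 4 (distinct_link alternating_or_closed)) (ear_states 3)"
  by code_simp

lemma transitions2: "list_all (transition_ok 4 2 link2 ends_equal ends_differ) (ear_transitions 4)"
  by code_simp

lemma transitions3: "list_all (transition_ok 3 3 link3 never ends_equal) (ear_transitions 3)"
  by code_simp

section \<open>Soundness of the examination\<close>

lemma path_search_sound:
  "path_search j n s e R C \<Longrightarrow> length R = n \<Longrightarrow> distinct (s # R) \<Longrightarrow> set C \<subseteq> set R \<Longrightarrow>
    hamiltonian_path (set (s # R)) (list_recolor j) s e"
proof (induction j n s e R C rule: path_search.induct)
  case (1 j s e R C)
  then show ?case by (auto simp: hamiltonian_path_def intro!: exI[of _ "[s]"])
next
  case (3 j n s e R x C)
  show ?case
  proof (cases "list_recolor j s x \<and> path_search j n x e (remove1 x R) (remove1 x R)")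
    case True
    have "hamiltonian_path (set (x # remove1 x R)) (list_recolor j) x e"
      using 3(1) True "3.prems" by (auto simp: length_remove1)
    moreover have "set (x # remove1 x R) = set R" using "3.prems" by auto
    ultimately obtain xs where xs: "distinct xs" "set xs = set R" "successively (list_recolor j) xs"
      "xs \<noteq> []" "hd xs = x" "last xs = e"
      unfolding hamiltonian_path_def by auto
    then show ?thesis using True "3.prems" unfolding hamiltonian_path_def
      by (intro exI[of _ "s # xs"]) (auto simp: successively_Cons)
  next
    case False
    then show ?thesis using 3(2,3) "3.prems" by (cases "list_recolor j s x") auto
  qed
qed simp_all

lemma all_joined_sound:
  assumes "all_joined j F ps" "(s, e) \<in> set ps" "distinct F" "s \<in> set F"
  shows "hamiltonian_path (set F) (list_recolor j) s e"
proof -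
  have "path_search j (length F - 1) s e (remove1 s F) (remove1 s F)"
    using assms(1,2) by (induction j F ps rule: all_joined.induct) (auto split: if_splits)
  from path_search_sound[OF this] assms(3,4) show ?thesis
    by (simp add: length_remove1 insert_absorb)
qed

lemma distinct_fibre: "distinct (fibre k n \<sigma>)"
  by (cases \<sigma>) (auto simp: fibre_def intro!: distinct_filter distinct_n_lists)

definition linked where
  "linked k n link \<sigma> s e \<longleftrightarrow> s \<in> set (fibre k n \<sigma>) \<and> e \<in> set (fibre k n \<sigma>) \<and> link \<sigma> s e"

lemma links_joined_sound:
  "links_joined k j n link \<sigma> \<Longrightarrow> linked k n link \<sigma> s e \<Longrightarrow>
    hamiltonian_path (set (fibre k n \<sigma>)) (list_recolor j) s e"
  unfolding links_joined_def linked_def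
  by (rule all_joined_sound) (auto simp: distinct_fibre)

lemma hits_iff: "hits link \<sigma> R e \<longleftrightarrow> (\<exists>d\<in>set R. link \<sigma> d e)"
  by (induction R) auto

lemma missed_eq: "missed link \<sigma> R F = filter (\<lambda>e. \<not> hits link \<sigma> R e) F"
  by (induction F) auto

text \<open>The good sets of \<open>closed_chain_good\<close>; \<open>reaches\<close> is the
  corresponding test on lists.\<close>

definition covers where
  "covers k n link weak \<sigma> R \<longleftrightarrow>
    (\<exists>m. \<forall>e\<in>set (fibre k n \<sigma>). (weak \<sigma> \<and> e = m) \<or> (\<exists>d\<in>R. linked k n link \<sigma> d e))"

lemma coversI:
  assumes "reaches k n link weak \<sigma> Q" "set Q \<inter> set (fibre k n \<sigma>) \<subseteq> R"
  shows "covers k n link weak \<sigma> R"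
proof -
  let ?M = "missed link \<sigma> (filter (List.member (fibre k n \<sigma>)) Q) (fibre k n \<sigma>)"
  have hit: "\<exists>d\<in>R. linked k n link \<sigma> d e" if "e \<in> set (fibre k n \<sigma>)" "e \<notin> set ?M" for e
    using that assms(2) by (auto simp: missed_eq hits_iff linked_def)
  have "length ?M \<le> (if weak \<sigma> then 1 else 0)" using assms(1) by (simp add: reaches_def)
  then have "?M = [] \<or> (weak \<sigma> \<and> (\<exists>m. ?M = [m]))"
    by (cases ?M) (auto split: if_splits)
  then show ?thesis unfolding covers_def using hit by (metis empty_iff list.set(1) list.simps(15) singletonD)
qed

text \<open>The reachable set grows from a single element at \<open>p\<close>. At \<open>q\<close>,
  which is not weak, any element can be returned to. As \<open>p \<noteq> q\<close>, rotating
  \<open>q\<close> to the end leaves \<open>p\<close> somewhere before it.\<close>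

lemma closed_chain_transitions:
  assumes ok: "list_all (transition_ok k n link weak special)
      (filter allowed (List.product S S))"
    and S: "\<And>\<sigma>. \<sigma> \<in> set S \<Longrightarrow> fibre k n \<sigma> \<noteq> []"
    and weak: "\<And>\<sigma>. special \<sigma> \<Longrightarrow> \<not> weak \<sigma>"
    and cyc: "cyclically (\<lambda>\<sigma> \<tau>. allowed (\<sigma>, \<tau>)) ss" "set ss \<subseteq> set S"
    and pq: "p \<in> set ss" "q \<in> set ss" "p \<noteq> q" "special p" "special q"
  shows "closed_chain (linked k n link) ss"
proof -
  have ok': "transition_ok k n link weak special (\<sigma>, \<tau>)"
    if "\<sigma> \<in> set S" "\<tau> \<in> set S" "allowed (\<sigma>, \<tau>)" for \<sigma> \<tau>
    using bspec[OF ok[unfolded list_all_iff], of "(\<sigma>, \<tau>)"] that by simp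
  obtain xs ys where ss: "ss = xs @ q # ys" using pq(2) split_list by metis
  then have "p \<in> set (ys @ xs)" using pq by auto
  then obtain as bs where ab: "ys @ xs = as @ p # bs" using split_list by metis
  have "closed_chain (linked k n link) ((ys @ xs) @ [q])"
  proof (rule closed_chain_good[where A = "set S" and allowed = "\<lambda>\<sigma> \<tau>. allowed (\<sigma>, \<tau>)"
        and D = "\<lambda>\<sigma>. set (fibre k n \<sigma>)" and good = "covers k n link weak"])
    show "cyclically (\<lambda>\<sigma> \<tau>. allowed (\<sigma>, \<tau>)) ((ys @ xs) @ [q])"
      using cyclically_rotate[of _ "xs @ [q]" ys] cyc ss by simp
    show "set ((ys @ xs) @ [q]) \<subseteq> set S" using cyc ss by auto
    show "(ys @ xs) @ [q] = as @ p # bs @ [q]" using ab by simp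
    show "set (fibre k n q) \<noteq> {}" using S[of q] subsetD[OF cyc(2) pq(2)] by simp
  next
    fix \<sigma> \<tau> s assume "\<sigma> \<in> set S" "\<tau> \<in> set S" "allowed (\<sigma>, \<tau>)" "s \<in> set (fibre k n \<sigma>)"
    then have "greedy_ok k n link \<sigma> \<tau> s" using ok' by (auto simp: transition_ok_def list_all_iff)
    then show "\<exists>e\<in>set (fibre k n \<sigma>) \<inter> set (fibre k n \<tau>). linked k n link \<sigma> s e"
      using \<open>s \<in> set (fibre k n \<sigma>)\<close>
      by (auto simp: greedy_ok_def filter_empty_conv linked_def)
  next
    fix \<sigma> \<tau> R assume st: "\<sigma> \<in> set S" "\<tau> \<in> set S" "allowed (\<sigma>, \<tau>)" and R: "covers k n link weak \<sigma> R"
    from R obtain m where m: "\<And>e. e \<in> set (fibre k n \<sigma>) \<Longrightarrow>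
        (weak \<sigma> \<and> e = m) \<or> (\<exists>d\<in>R. linked k n link \<sigma> d e)"
      unfolding covers_def by blast
    \<comment> \<open>\<open>m\<close> may lie outside the fibre, whereas \<open>step_ok\<close> is
      tested for its elements only. In that case nothing is missing, and any element may play the
      part of \<open>m\<close>.\<close>
    obtain m' where m': "m' \<in> set (fibre k n \<sigma>)" "m \<in> set (fibre k n \<sigma>) \<Longrightarrow> m' = m"
      using S[OF st(1)] by (metis list.set_intros(1) neq_Nil_conv)
    then have "step_ok k n link weak \<sigma> \<tau> m'"
      using ok'[OF st] by (auto simp: transition_ok_def list_all_iff)
    then show "covers k n link weak \<tau> {e. \<exists>d\<in>R. linked k n link \<sigma> d e}"
      unfolding step_ok_def by (rule coversI) (use m m' in \<open>auto split: if_splits\<close>)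
  next
    fix \<tau> s assume st: "\<tau> \<in> set S" "allowed (p, \<tau>)" and s: "s \<in> set (fibre k n p)"
    have "p \<in> set S" using pq cyc by auto
    then have "start_ok k n link weak p \<tau> s"
      using ok'[of p \<tau>] st s pq(4) by (auto simp: transition_ok_def list_all_iff)
    then show "covers k n link weak \<tau> {e. linked k n link p s e}"
      unfolding start_ok_def by (rule coversI) (use s in \<open>auto simp: linked_def\<close>)
  next
    fix R e assume "covers k n link weak q R" "e \<in> set (fibre k n q)"
    then show "\<exists>d\<in>R. linked k n link q d e" using weak[OF pq(5)] unfolding covers_def by blast
  qed
  then show ?thesis using closed_chain_rotate[of _ "ys" "xs @ [q]"] ss by simp
qed

lemma meets_two:
  assumes "meets 2 k n P (\<sigma>, \<tau>)"
  shows "\<exists>c d. c \<noteq> d \<and> {c, d} \<subseteq> {s \<in> set (fibre k n \<sigma>). P s} \<inter> {s \<in> set (fibre k n \<tau>). P s}"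
proof -
  let ?L = "filter (List.member (filter P (fibre k n \<tau>))) (filter P (fibre k n \<sigma>))"
  have "2 \<le> length ?L" using assms by (simp add: meets_def)
  then obtain c d L where L: "?L = c # d # L" by (auto simp: numeral_2_eq_2 Suc_le_length_iff)
  have "distinct ?L" by (simp add: distinct_fibre)
  then have "c \<noteq> d" unfolding L by simp
  moreover have "{c, d} \<subseteq> set ?L" unfolding L by simp
  then have "{c, d} \<subseteq> {s \<in> set (fibre k n \<sigma>). P s} \<inter> {s \<in> set (fibre k n \<tau>). P s}"
    by auto
  ultimately show ?thesis by blast
qed

lemma meets_one:
  assumes "meets 1 k n any_list (\<sigma>, \<tau>)"
  shows "set (fibre k n \<sigma>) \<inter> set (fibre k n \<tau>) \<noteq> {}"
proof -
  let ?L = "filter (List.member (filter any_list (fibre k n \<tau>))) (filter any_list (fibre k n \<sigma>))"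
  have "?L \<noteq> []" using assms by (auto simp: meets_def)
  then show ?thesis by (auto simp: filter_empty_conv)
qed

lemma hamiltonian_path_rtranclp:
  assumes "hamiltonian_path A R s e"
  shows "(\<lambda>c d. c \<in> A \<and> d \<in> A \<and> R c d)\<^sup>*\<^sup>* s e"
proof -
  have "(\<lambda>c d. c \<in> A \<and> d \<in> A \<and> R c d)\<^sup>*\<^sup>* (hd xs) (last xs)"
    if "successively R xs" "xs \<noteq> []" "set xs \<subseteq> A" for xs
    using that
  proof (induction xs rule: induct_list012)
    case (3 x y zs)
    then have "(\<lambda>c d. c \<in> A \<and> d \<in> A \<and> R c d)\<^sup>*\<^sup>* y (last (y # zs))" by simp
    with 3 show ?case by (auto intro: converse_rtranclp_into_rtranclp)
  qed auto
  then show ?thesis using assms unfolding hamiltonian_path_def by blast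
qed

section \<open>Extension of Hamiltonicity and connectivity from one graph to the next\<close>

definition cyclic_colorings :: "nat \<Rightarrow> nat \<Rightarrow> 'a set \<Rightarrow> 'a rel \<Rightarrow> bool" where
  "cyclic_colorings k j V E \<longleftrightarrow> (\<exists>xs. hamiltonian_cycle (colorings k V E) (recolor j E) xs)"

definition connected_colorings :: "nat \<Rightarrow> nat \<Rightarrow> 'a set \<Rightarrow> 'a rel \<Rightarrow> bool" where
  "connected_colorings k j V E \<longleftrightarrow> (\<forall>\<phi>\<in>colorings k V E. \<forall>\<psi>\<in>colorings k V E.
    (\<lambda>\<phi> \<psi>. \<phi> \<in> colorings k V E \<and> \<psi> \<in> colorings k V E \<and> recolor j E \<phi> \<psi>)\<^sup>*\<^sup>* \<phi> \<psi>)"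

lemma cyclically_map:
  "xs \<noteq> [] \<Longrightarrow> cyclically R (map f xs) \<longleftrightarrow> cyclically (\<lambda>x y. R (f x) (f y)) xs"
  by (simp add: cyclically_def successively_map hd_map last_map)

lemma cyclically_mono:
  assumes "cyclically R xs" "xs \<noteq> []" "\<And>x y. x \<in> set xs \<Longrightarrow> y \<in> set xs \<Longrightarrow> R x y \<Longrightarrow> R' x y"
  shows "cyclically R' xs"
  using assms unfolding cyclically_def by (auto intro: successively_mono)

context path_extension
begin

lemma cyclic_colorings_avoiding:
  assumes ham: "cyclic_colorings k j V E"
    and links: "list_all (links_joined k j (length p) (distinct_link P)) S"
    and S: "\<And>\<phi>. \<phi> \<in> colorings k V E \<Longrightarrow> state \<phi> \<in> set S"
    and meets: "list_all (meets 2 k (length p) P) Tr"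
    and Tr: "\<And>\<phi> \<psi>. \<phi> \<in> colorings k V E \<Longrightarrow> \<psi> \<in> colorings k V E \<Longrightarrow> recolor j E \<phi> \<psi> \<Longrightarrow>
      (state \<phi>, state \<psi>) \<in> set Tr"
    and u: "us = [u]" "\<And>a. a \<in> {1..k} \<Longrightarrow> \<exists>\<phi>\<in>colorings k V E. \<phi> u = a"
  shows "cyclic_colorings k j V' E'"
proof -
  from ham obtain xs where xs: "hamiltonian_cycle (colorings k V E) (recolor j E) xs"
    unfolding cyclic_colorings_def by blast
  then have set_xs: "set xs = colorings k V E" and len: "3 \<le> length xs"
    and cyc: "cyclically (recolor j E) xs"
    by (auto simp: hamiltonian_cycle_def)
  let ?T = "linked k (length p) (distinct_link P)"
  have "closed_chain ?T (map state xs)"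
  proof (rule closed_chain_avoiding[where A = "state ` colorings k V E"
        and D = "\<lambda>\<sigma>. {s \<in> set (fibre k (length p) \<sigma>). P s}" and allowed = "\<lambda>\<sigma> \<tau>. (\<sigma>, \<tau>) \<in> set Tr"])
    show "cyclically (\<lambda>\<sigma> \<tau>. (\<sigma>, \<tau>) \<in> set Tr) (map state xs)"
      using len set_xs by (subst cyclically_map) (auto intro!: Tr cyclically_mono[OF cyc])
    \<comment> \<open>The first color of a list lying in every fibre would differ from the color of
      \<open>u\<close> in every coloring, but \<open>u\<close> takes all colors.\<close>
    show "\<exists>\<tau>\<in>set (map state xs). c \<notin> {s \<in> set (fibre k (length p) \<tau>). P s}" for c
    proof (rule ccontr)
      assume "\<not> ?thesis"
      then have c: "c \<in> Fib k \<phi>" if "\<phi> \<in> colorings k V E" for \<phi> using that set_xs by auto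
      have "colorings k V E \<noteq> {}" using set_xs len by auto
      then have len: "length c = length p" "set c \<subseteq> {1..k}" using c fibreD by blast+
      then have "c \<noteq> []" using p by auto
      then have "hd c \<in> {1..k}" using len by (meson hd_in_set subsetD)
      from u(2)[OF this] obtain \<phi> where "\<phi> \<in> colorings k V E" "\<phi> u = hd c" by blast
      moreover have "state \<phi> = ([\<phi> u], map \<phi> ws)" unfolding state_def using u(1) by simp
      ultimately show False using c[of \<phi>] \<open>c \<noteq> []\<close>
        by (auto simp: set_fibre successively_Cons)
    qed
    show "\<exists>c d. c \<noteq> d \<and> {c, d} \<subseteq> {s \<in> set (fibre k (length p) \<sigma>). P s} \<inter> {s \<in> set (fibre k (length p) \<tau>). P s}"
      if "(\<sigma>, \<tau>) \<in> set Tr" for \<sigma> \<tau>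
      using meets that by (intro meets_two) (auto simp: list_all_iff)
  qed (use len set_xs in \<open>auto simp: linked_def distinct_link_def\<close>)
  from hamiltonian_cycle_extension[OF xs this] links S show ?thesis
    unfolding cyclic_colorings_def by (auto simp: list_all_iff intro: links_joined_sound)
qed

lemma cyclic_colorings_transitions:
  assumes ham: "cyclic_colorings k j V E"
    and links: "list_all (links_joined k j (length p) link) S"
    and S: "\<And>\<phi>. \<phi> \<in> colorings k V E \<Longrightarrow> state \<phi> \<in> set S"
    and ne: "\<And>\<sigma>. \<sigma> \<in> set S \<Longrightarrow> fibre k (length p) \<sigma> \<noteq> []"
    and ok: "list_all (transition_ok k (length p) link weak special) (filter allowed (List.product S S))"
    and allowed: "\<And>\<phi> \<psi>. \<phi> \<in> colorings k V E \<Longrightarrow> \<psi> \<in> colorings k V E \<Longrightarrow> recolor j E \<phi> \<psi> \<Longrightarrow>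
      allowed (state \<phi>, state \<psi>)"
    and weak: "\<And>\<sigma>. special \<sigma> \<Longrightarrow> \<not> weak \<sigma>"
    and special: "\<phi> \<in> colorings k V E" "\<psi> \<in> colorings k V E" "state \<phi> \<noteq> state \<psi>"
      "special (state \<phi>)" "special (state \<psi>)"
  shows "cyclic_colorings k j V' E'"
proof -
  from ham obtain xs where xs: "hamiltonian_cycle (colorings k V E) (recolor j E) xs"
    unfolding cyclic_colorings_def by blast
  then have set_xs: "set xs = colorings k V E" and len: "3 \<le> length xs"
    and cyc: "cyclically (recolor j E) xs"
    by (auto simp: hamiltonian_cycle_def)
  have "closed_chain (linked k (length p) link) (map state xs)"
  proof (rule closed_chain_transitions[OF ok ne weak])
    show "cyclically (\<lambda>\<sigma> \<tau>. allowed (\<sigma>, \<tau>)) (map state xs)"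
      using len set_xs by (subst cyclically_map) (auto intro!: allowed cyclically_mono[OF cyc])
    show "set (map state xs) \<subseteq> set S" using S set_xs by auto
    show "state \<phi> \<in> set (map state xs)" "state \<psi> \<in> set (map state xs)" using special set_xs by auto
  qed (use special in auto)
  from hamiltonian_cycle_extension[OF xs this] links S show ?thesis
    unfolding cyclic_colorings_def by (auto simp: list_all_iff intro: links_joined_sound)
qed

lemma connected_colorings_extension:
  assumes conn: "connected_colorings k j V E"
    and links: "list_all (links_joined k j (length p) (distinct_link any_list)) S"
    and S: "\<And>\<phi>. \<phi> \<in> colorings k V E \<Longrightarrow> state \<phi> \<in> set S"
    and meets: "list_all (meets 1 k (length p) any_list) Tr"
    and Tr: "\<And>\<phi> \<psi>. \<phi> \<in> colorings k V E \<Longrightarrow> \<psi> \<in> colorings k V E \<Longrightarrow> recolor j E \<phi> \<psi> \<Longrightarrow>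
      (state \<phi>, state \<psi>) \<in> set Tr"
  shows "connected_colorings k j V' E'"
proof -
  have fib: "(\<lambda>cs ds. cs \<in> Fib k \<phi> \<and> ds \<in> Fib k \<phi> \<and> list_recolor j cs ds)\<^sup>*\<^sup>* cs ds"
    if "\<phi> \<in> colorings k V E" "cs \<in> Fib k \<phi>" "ds \<in> Fib k \<phi>" for \<phi> cs ds
  proof (cases "cs = ds")
    case False
    then have "linked k (length p) (distinct_link any_list) (state \<phi>) cs ds"
      using that by (simp add: linked_def distinct_link_def any_list_def)
    then show ?thesis using links S that(1)
      by (intro hamiltonian_path_rtranclp links_joined_sound[where link = "distinct_link any_list"])
        (auto simp: list_all_iff)
  qed simp
  have meet: "Fib k \<phi> \<inter> Fib k \<psi> \<noteq> {}"
    if "\<phi> \<in> colorings k V E" "\<psi> \<in> colorings k V E" "recolor j E \<phi> \<psi>" for \<phi> \<psi>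
    using meets Tr[OF that] by (intro meets_one) (auto simp: list_all_iff)
  from conn show ?thesis
    unfolding connected_colorings_def[of _ _ V E] unfolding connected_colorings_def
    using colorings_connected_extension[of k j, OF _ fib meet] by blast
qed

end

section \<open>Attaching paths\<close>

text \<open>This provides the states needed to close the chain. For a loop the ends can only have
  equal colors, hence the premise on \<open>u = w\<close>.\<close>

definition realizable :: "nat \<Rightarrow> 'a set \<Rightarrow> 'a rel \<Rightarrow> 'a \<Rightarrow> 'a \<Rightarrow> bool" where
  "realizable k V E u w \<longleftrightarrow> (\<forall>c\<in>{1..k}. \<forall>d\<in>{1..k}. (u = w \<longrightarrow> c = d) \<longrightarrow>
    (\<exists>\<phi>\<in>colorings k V E. \<phi> u = c \<and> \<phi> w = d))"

lemma realizableD: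
  "realizable k V E u w \<Longrightarrow> c \<in> {1..k} \<Longrightarrow> d \<in> {1..k} \<Longrightarrow> u = w \<longrightarrow> c = d \<Longrightarrow>
    \<exists>\<phi>\<in>colorings k V E. \<phi> u = c \<and> \<phi> w = d"
  unfolding realizable_def by blast

lemma coloringsD: "\<phi> \<in> colorings k V E \<Longrightarrow> v \<in> V \<Longrightarrow> \<phi> v \<in> {1..k}"
  unfolding colorings_def by auto

text \<open>Two distinct vertices do not fit on a path with one vertex, and on a path with two
  vertices they are adjacent. This limits the state changes of an ear to
  \<open>ear_transitions\<close>.\<close>

lemma recolor_nonadjacent:
  assumes "recolor j E \<phi> \<psi>" "u \<noteq> w" "j = 1 \<or> j = 2 \<and> (u, w) \<notin> E \<and> (w, u) \<notin> E"
  shows "\<phi> u = \<psi> u \<or> \<phi> w = \<psi> w"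
proof (rule ccontr)
  assume "\<not> ?thesis"
  with assms(1) obtain q where q: "distinct q" "length q \<le> j" "successively (\<lambda>x y. (x, y) \<in> E) q"
    "u \<in> set q" "w \<in> set q"
    unfolding recolor_def by auto
  then have "length q \<le> 2" using assms(3) by auto
  then consider "q = []" | x where "q = [x]" | x y where "q = [x, y]"
    by (cases q rule: remdups_adj.cases) auto
  then show False using q assms(2,3) by cases auto
qed

lemma pendant_state: "a \<in> {1..k} \<Longrightarrow> ([a], []) \<in> set (pendant_states k)"
  by (auto simp: pendant_states_def)

lemma loop_state: "a \<in> {1..k} \<Longrightarrow> ([a], [a]) \<in> set (loop_states k)"
  by (auto simp: loop_states_def)

lemma ear_state: "a \<in> {1..k} \<Longrightarrow> b \<in> {1..k} \<Longrightarrow> ([a], [b]) \<in> set (ear_states k)"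
  by (auto simp: ear_states_def)

lemma leaf_cyclic_colorings:
  assumes "E \<subseteq> V \<times> V" "u \<in> V" "x \<notin> V" "cyclic_colorings 4 1 V E" "realizable 4 V E u w"
  shows "cyclic_colorings 4 1 (insert x V) (E \<union> {(u, x), (x, u)})"
proof -
  interpret path_extension V E "[u]" "[x]" "[]" by unfold_locales (use assms in auto)
  have S: "state \<phi> \<in> set (pendant_states 4)" if "\<phi> \<in> colorings 4 V E" for \<phi>
    using coloringsD[OF that assms(2)] by (auto simp: state_def intro: pendant_state)
  have u: "\<exists>\<phi>\<in>colorings 4 V E. \<phi> u = a" if "a \<in> {1..4}" for a
    using realizableD[OF assms(5) that that] by blast
  have "cyclic_colorings 4 1 V' E'"
    by (rule cyclic_colorings_avoiding[where S = "pendant_states 4" and P = any_list and u = u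
          and Tr = "List.product (pendant_states 4) (pendant_states 4)"])
      (use assms S pendant_links pendant_meets u in auto)
  then show ?thesis by simp
qed

lemma pendant_path_cyclic_colorings:
  assumes "E \<subseteq> V \<times> V" "u \<in> V" "x \<notin> V" "y \<notin> V" "x \<noteq> y" "cyclic_colorings 3 2 V E"
    "realizable 3 V E u w"
  shows "cyclic_colorings 3 2 (V \<union> {x, y}) (E \<union> path_arcs [u, x, y])"
proof -
  interpret path_extension V E "[u]" "[x, y]" "[]" by unfold_locales (use assms in auto)
  have S: "state \<phi> \<in> set (pendant_states 3)" if "\<phi> \<in> colorings 3 V E" for \<phi>
    using coloringsD[OF that assms(2)] by (auto simp: state_def intro: pendant_state)
  have "\<exists>\<phi>\<in>colorings 3 V E. \<phi> u = a" if "a \<in> {1..3}" for a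
    using realizableD[OF assms(7) that that] by blast
  then have "cyclic_colorings 3 2 V' E'"
    by (intro cyclic_colorings_avoiding[where S = "pendant_states 3" and P = any_list and u = u
          and Tr = "List.product (pendant_states 3) (pendant_states 3)"])
      (use assms S pendant_links pendant_meets in \<open>auto simp: numeral_2_eq_2[symmetric]\<close>)
  then show ?thesis by simp
qed

lemma realizable_leaf:
  assumes "E \<subseteq> V \<times> V" "u \<in> V" "w \<in> V" "u \<noteq> w" "x \<notin> V" "3 \<le> k" "realizable k V E u w"
  shows "realizable k (insert x V) (E \<union> {(u, x), (x, u)}) x w"
proof -
  interpret path_extension V E "[u]" "[x]" "[]" by unfold_locales (use assms in auto)
  show ?thesis unfolding realizable_def
  proof (intro ballI impI)
    fix c d assume c: "c \<in> {1..k}" and d: "d \<in> {1..k}"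
    \<comment> \<open>Any color for \<open>u\<close> other than \<open>c\<close>; as
      \<open>u \<noteq> w\<close>, it can be prescribed independently of \<open>d\<close>.\<close>
    define a where "a = (if c = 1 then 2 else (1::nat))"
    have a: "a \<in> {1..k}" "a \<noteq> c" using assms(6) by (auto simp: a_def)
    obtain \<phi> where \<phi>: "\<phi> \<in> colorings k V E" "\<phi> u = a" "\<phi> w = d"
      using realizableD[OF assms(7) a(1) d] assms(4) by blast
    have "[c] \<in> Fib k \<phi>" using a c \<phi> by (auto simp: state_def set_fibre)
    from colorings_glue[OF \<phi>(1) this] glue_old[of "[c]" w \<phi>] \<phi> assms
    show "\<exists>\<psi>\<in>colorings k (insert x V) (E \<union> {(u, x), (x, u)}). \<psi> x = c \<and> \<psi> w = d"
      by (intro bexI[of _ "glue [x] \<phi> [c]"]) (auto simp: glue_def)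
  qed
qed

lemma realizable_pendant_path:
  assumes "E \<subseteq> V \<times> V" "u \<in> V" "w \<in> V" "x \<notin> V" "y \<notin> V" "x \<noteq> y" "3 \<le> k" "realizable k V E u w"
  shows "realizable k (V \<union> {x, y}) (E \<union> path_arcs [u, x, y]) y w"
proof -
  interpret path_extension V E "[u]" "[x, y]" "[]" by unfold_locales (use assms in auto)
  show ?thesis unfolding realizable_def
  proof (intro ballI impI)
    fix c d assume c: "c \<in> {1..k}" and d: "d \<in> {1..k}"
    obtain b where b: "b \<in> {1..k}" "b \<noteq> c" "b \<noteq> d"
    proof -
      have "1 \<in> {1..k}" "2 \<in> {1..k}" "3 \<in> {1..k}" using assms(7) by auto
      moreover have "(1 \<noteq> c \<and> 1 \<noteq> d) \<or> (2 \<noteq> c \<and> 2 \<noteq> d) \<or> (3 \<noteq> c \<and> 3 \<noteq> d)" by arith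
      ultimately show thesis using that by blast
    qed
    \<comment> \<open>Giving \<open>u\<close> the color \<open>d\<close> as well is admissible even
      if \<open>u = w\<close>, so this also serves loops; \<open>b\<close> avoids the colors of both
      its neighbours.\<close>
    obtain \<phi> where \<phi>: "\<phi> \<in> colorings k V E" "\<phi> u = d" "\<phi> w = d"
      using realizableD[OF assms(8) d d] by blast
    have "[b, c] \<in> Fib k \<phi>" using b c \<phi> by (auto simp: state_def set_fibre)
    from colorings_glue[OF \<phi>(1) this] glue_old[of "[b, c]" w \<phi>] \<phi> assms
    show "\<exists>\<psi>\<in>colorings k (V \<union> {x, y}) (E \<union> path_arcs [u, x, y]). \<psi> y = c \<and> \<psi> w = d"
      by (intro bexI[of _ "glue [x, y] \<phi> [b, c]"]) (auto simp: glue_def)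
  qed
qed

lemma ear_of_two_cyclic_colorings:
  assumes "E \<subseteq> V \<times> V" "u \<in> V" "w \<in> V" "u \<noteq> w" "x \<notin> V" "y \<notin> V" "x \<noteq> y" "cyclic_colorings 4 1 V E"
    "realizable 4 V E u w"
  shows "cyclic_colorings 4 1 (V \<union> {x, y}) (E \<union> path_arcs [u, x, y, w])"
proof -
  interpret path_extension V E "[u]" "[x, y]" "[w]" by unfold_locales (use assms in auto)
  have S: "state \<phi> \<in> set (ear_states 4)" if "\<phi> \<in> colorings 4 V E" for \<phi>
    using coloringsD[OF that] assms(2,3) by (auto simp: state_def intro!: ear_state)
  have realize: "\<exists>\<phi>\<in>colorings 4 V E. state \<phi> = ([c], [d])" if "c \<in> {1..4}" "d \<in> {1..4}" for c d
    using realizableD[OF assms(9) that] assms(4) by (auto simp: state_def)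
  obtain \<phi> \<psi> where \<phi>\<psi>: "\<phi> \<in> colorings 4 V E" "\<psi> \<in> colorings 4 V E" "state \<phi> = ([1], [2])" "state \<psi> = ([2], [1])"
    using realize[of 1 2] realize[of 2 1] by auto
  \<comment> \<open>Over equal ends an element is linked to only two others, too few for a start, so
    different ends are special. Equal ends have to be weak: after a start at 23 over ends 1, 2, no
    traversal over ends 1, 1 leads to 43.\<close>
  have "cyclic_colorings 4 1 V' E'"
  proof (rule cyclic_colorings_transitions[where S = "ear_states 4" and link = link2
        and special = ends_differ and weak = ends_equal and allowed = one_end_fixed and \<phi> = \<phi> and \<psi> = \<psi>])
    show "list_all (links_joined 4 1 (length [x, y]) link2) (ear_states 4)" using links2 by (simp add: numeral_2_eq_2[symmetric])
    show "list_all (transition_ok 4 (length [x, y]) link2 ends_equal ends_differ)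
      (filter one_end_fixed (List.product (ear_states 4) (ear_states 4)))"
      using transitions2 by (simp add: ear_transitions_def numeral_2_eq_2[symmetric])
    show "fibre 4 (length [x, y]) \<sigma> \<noteq> []" if "\<sigma> \<in> set (ear_states 4)" for \<sigma>
    proof -
      have "list_all (\<lambda>\<sigma>. fibre 4 2 \<sigma> \<noteq> []) (ear_states 4)" by code_simp
      then show ?thesis using that by (auto simp: list_all_iff numeral_2_eq_2[symmetric])
    qed
    show "one_end_fixed (state \<phi>, state \<psi>)"
      if "recolor 1 E \<phi> \<psi>" for \<phi> \<psi>
      using recolor_nonadjacent[OF that assms(4)] by (auto simp: one_end_fixed_def state_def)
  qed (use assms S \<phi>\<psi> in \<open>auto simp: ends_equal_def ends_differ_def\<close>)
  then show ?thesis by simp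
qed

text \<open>For different ends \<open>closed_chain_avoiding\<close> is out of reach. The fibre over
  ends a, b shares only bca and cba with the one over a, c, and only bca and bac with the one over
  c, b. Two common elements each time would require both cba and bac, the central pair.\<close>

lemma ear_of_three_cyclic_colorings:
  assumes "E \<subseteq> V \<times> V" "u \<in> V" "w \<in> V" "u \<noteq> w \<Longrightarrow> (u, w) \<notin> E \<and> (w, u) \<notin> E"
    and path: "length p = 3" "distinct p" "set p \<inter> V = {}" and "cyclic_colorings 3 2 V E"
    "realizable 3 V E u w"
  shows "cyclic_colorings 3 2 (V \<union> set p) (E \<union> path_arcs (u # p @ [w]))"
proof -
  interpret path_extension V E "[u]" p "[w]" by unfold_locales (use assms in auto)
  have "cyclic_colorings 3 2 V' E'"
  proof (cases "u = w")
    case True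
    have S: "state \<phi> \<in> set (loop_states 3)" if "\<phi> \<in> colorings 3 V E" for \<phi>
      unfolding state_def using coloringsD[OF that assms(2)] True by (simp add: loop_state)
    have u: "\<exists>\<phi>\<in>colorings 3 V E. \<phi> u = a" if "a \<in> {1..3}" for a
      using realizableD[OF assms(9) that that] by blast
    show ?thesis
      by (rule cyclic_colorings_avoiding[where S = "loop_states 3" and P = ends_match and u = u
          and Tr = "List.product (loop_states 3) (loop_states 3)"])
        (use assms S loop_links loop_meets u in auto)
  next
    case False
    have S: "state \<phi> \<in> set (ear_states 3)" if "\<phi> \<in> colorings 3 V E" for \<phi>
      using coloringsD[OF that] assms(2,3) by (auto simp: state_def intro!: ear_state)
    have realize: "\<exists>\<phi>\<in>colorings 3 V E. state \<phi> = ([c], [d])" if "c \<in> {1..3}" "d \<in> {1..3}" for c d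
      using realizableD[OF assms(9) that] False by (auto simp: state_def)
    obtain \<phi> \<psi> where \<phi>\<psi>: "\<phi> \<in> colorings 3 V E" "\<psi> \<in> colorings 3 V E" "state \<phi> = ([1], [1])" "state \<psi> = ([2], [2])"
      using realize[of 1 1] realize[of 2 2] by auto
    \<comment> \<open>Equal ends are special because a central start over different ends is too
      poor: bac over ends a, b leaves only bca over ends a, c, which is central there and hence not
      linked to the other central list.\<close>
    show ?thesis
    proof (rule cyclic_colorings_transitions[where S = "ear_states 3" and link = link3
          and special = ends_equal and weak = never and allowed = one_end_fixed and \<phi> = \<phi> and \<psi> = \<psi>])
      show "list_all (links_joined 3 2 (length p) link3) (ear_states 3)" using links3 path by simp
      show "list_all (transition_ok 3 (length p) link3 never ends_equal)
        (filter one_end_fixed (List.product (ear_states 3) (ear_states 3)))"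
        using transitions3 path by (simp add: ear_transitions_def)
      show "fibre 3 (length p) \<sigma> \<noteq> []" if "\<sigma> \<in> set (ear_states 3)" for \<sigma>
      proof -
        have "list_all (\<lambda>\<sigma>. fibre 3 3 \<sigma> \<noteq> []) (ear_states 3)" by code_simp
        then show ?thesis using that path by (auto simp: list_all_iff)
      qed
      show "one_end_fixed (state \<phi>, state \<psi>)"
        if "recolor 2 E \<phi> \<psi>" for \<phi> \<psi>
        using recolor_nonadjacent[OF that False] assms(4)[OF False] by (auto simp: one_end_fixed_def state_def)
    qed (use assms S \<phi>\<psi> in \<open>auto simp: never_def ends_equal_def\<close>)
  qed
  then show ?thesis by simp
qed

lemma ear_of_four_cyclic_colorings:
  assumes "E \<subseteq> V \<times> V" "u \<in> V" "w \<in> V" "u \<noteq> w \<Longrightarrow> (u, w) \<notin> E \<and> (w, u) \<notin> E"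
    and path: "length p = 4" "distinct p" "set p \<inter> V = {}" and "cyclic_colorings 3 2 V E"
    "realizable 3 V E u w"
  shows "cyclic_colorings 3 2 (V \<union> set p) (E \<union> path_arcs (u # p @ [w]))"
proof -
  interpret path_extension V E "[u]" p "[w]" by unfold_locales (use assms in auto)
  have S: "state \<phi> \<in> set (ear_states 3)" if "\<phi> \<in> colorings 3 V E" for \<phi>
    using coloringsD[OF that] assms(2,3) by (auto simp: state_def intro!: ear_state)
  have u: "\<exists>\<phi>\<in>colorings 3 V E. \<phi> u = a" if "a \<in> {1..3}" for a
    using realizableD[OF assms(9) that that] by blast
  \<comment> \<open>For \<open>u = w\<close> both ends change color together, which
    \<open>ear_transitions\<close> does not contain.\<close>
  let ?Tr = "ear_transitions 3 @ List.product (loop_states 3) (loop_states 3)"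
  have Tr: "(state \<phi>, state \<psi>) \<in> set ?Tr"
    if "\<phi> \<in> colorings 3 V E" "\<psi> \<in> colorings 3 V E" "recolor 2 E \<phi> \<psi>" for \<phi> \<psi>
  proof (cases "u = w")
    case True
    then show ?thesis unfolding state_def using coloringsD[OF _ assms(2)] that
      by (simp add: loop_state)
  next
    case False
    then show ?thesis using recolor_nonadjacent[OF that(3) False] assms(4) S[OF that(1)] S[OF that(2)]
      by (auto simp: ear_transitions_def one_end_fixed_def state_def)
  qed
  have "cyclic_colorings 3 2 V' E'"
    by (rule cyclic_colorings_avoiding[where S = "ear_states 3" and P = alternating_or_closed and u = u
          and Tr = ?Tr])
      (use assms S Tr links4 ear_meets loop_meets u in auto)
  then show ?thesis by simp
qed

section \<open>Ears of arbitrary length\<close>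

lemma ear_cyclic_colorings_4:
  assumes "E \<subseteq> V \<times> V" "u \<in> V" "w \<in> V" "u \<noteq> w" "cyclic_colorings 4 1 V E" "realizable 4 V E u w"
    "2 \<le> length p" "distinct p" "set p \<inter> V = {}"
  shows "cyclic_colorings 4 1 (V \<union> set p) (E \<union> path_arcs (u # p @ [w]))"
  using assms
proof (induction p arbitrary: V E u)
  case (Cons x p)
  show ?case
  proof (cases "length p = 1")
    case True
    then obtain y where "p = [y]" by (cases p) auto
    then show ?thesis using ear_of_two_cyclic_colorings[of E V u w x y] Cons.prems by simp
  next
    case False
    let ?V = "insert x V" and ?E = "E \<union> {(u, x), (x, u)}"
    have "cyclic_colorings 4 1 (?V \<union> set p) (?E \<union> path_arcs (x # p @ [w]))"
    proof (rule Cons.IH)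
      show "cyclic_colorings 4 1 ?V ?E"
        using Cons.prems by (intro leaf_cyclic_colorings[where w = w]) auto
      show "realizable 4 ?V ?E x w"
        using Cons.prems by (intro realizable_leaf) auto
      show "2 \<le> length p" using Cons.prems(7) False by (cases "length p") auto
    qed (use Cons.prems in auto)
    then show ?thesis by (simp add: Un_assoc insert_commute)
  qed
qed simp

text \<open>After attaching \<open>x\<close> and \<open>y\<close>, the remaining ear joins
  \<open>y\<close> to \<open>w\<close>. These are distinct and nonadjacent even if
  \<open>u = w\<close>, so a loop is handled as such only at length 3 or 4.\<close>

lemma ear_cyclic_colorings_3:
  assumes "E \<subseteq> V \<times> V" "u \<in> V" "w \<in> V" "u \<noteq> w \<Longrightarrow> (u, w) \<notin> E \<and> (w, u) \<notin> E"
    "cyclic_colorings 3 2 V E" "realizable 3 V E u w" "3 \<le> length p" "distinct p" "set p \<inter> V = {}"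
  shows "cyclic_colorings 3 2 (V \<union> set p) (E \<union> path_arcs (u # p @ [w]))"
  using assms
proof (induction "length p" arbitrary: p V E u rule: less_induct)
  case less
  consider "length p = 3" | "length p = 4" | "5 \<le> length p" using less.prems(7) by linarith
  then show ?case
  proof cases
    case 3
    then obtain x y q where p: "p = x # y # q" by (cases p rule: remdups_adj.cases) auto
    with 3 have q: "3 \<le> length q" by simp
    let ?V = "V \<union> {x, y}" and ?E = "E \<union> path_arcs [u, x, y]"
    have "cyclic_colorings 3 2 (?V \<union> set q) (?E \<union> path_arcs (y # q @ [w]))"
    proof (rule less.hyps)
      show "cyclic_colorings 3 2 ?V ?E"
        using less.prems p by (intro pendant_path_cyclic_colorings[where w = w]) auto
      show "realizable 3 ?V ?E y w"
        using less.prems p by (intro realizable_pendant_path) auto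
    qed (use less.prems p q in auto)
    then show ?thesis by (simp add: p Un_assoc insert_commute)
  qed (use less.prems ear_of_three_cyclic_colorings[of E V u w p]
      ear_of_four_cyclic_colorings[of E V u w p] in auto)
qed

section \<open>Connectivity for three colors\<close>

lemma leaf_connected_colorings:
  assumes "E \<subseteq> V \<times> V" "u \<in> V" "x \<notin> V" "connected_colorings 3 2 V E"
  shows "connected_colorings 3 2 (insert x V) (E \<union> {(u, x), (x, u)})"
proof -
  interpret path_extension V E "[u]" "[x]" "[]" by unfold_locales (use assms in auto)
  have S: "state \<phi> \<in> set (pendant_states 3)" if "\<phi> \<in> colorings 3 V E" for \<phi>
    using coloringsD[OF that assms(2)] by (auto simp: state_def intro: pendant_state)
  have "connected_colorings 3 2 V' E'"
    by (rule connected_colorings_extension[where S = "pendant_states 3"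
          and Tr = "List.product (pendant_states 3) (pendant_states 3)"])
      (use assms S pendant_links pendant_meets in auto)
  then show ?thesis by simp
qed

lemma ear_of_two_connected_colorings:
  assumes "E \<subseteq> V \<times> V" "u \<in> V" "w \<in> V" "u \<noteq> w" "(u, w) \<notin> E" "(w, u) \<notin> E" "x \<notin> V" "y \<notin> V" "x \<noteq> y"
    "connected_colorings 3 2 V E"
  shows "connected_colorings 3 2 (V \<union> {x, y}) (E \<union> path_arcs [u, x, y, w])"
proof -
  interpret path_extension V E "[u]" "[x, y]" "[w]" by unfold_locales (use assms in auto)
  have S: "state \<phi> \<in> set (ear_states 3)" if "\<phi> \<in> colorings 3 V E" for \<phi>
    using coloringsD[OF that] assms(2,3) by (auto simp: state_def intro!: ear_state)
  have Tr: "(state \<phi>, state \<psi>) \<in> set (ear_transitions 3)"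
    if "\<phi> \<in> colorings 3 V E" "\<psi> \<in> colorings 3 V E" "recolor 2 E \<phi> \<psi>" for \<phi> \<psi>
    using recolor_nonadjacent[OF that(3) assms(4)] assms(5,6) S[OF that(1)] S[OF that(2)]
    by (auto simp: ear_transitions_def one_end_fixed_def state_def)
  have "connected_colorings 3 2 V' E'"
    by (rule connected_colorings_extension[where S = "ear_states 3" and Tr = "ear_transitions 3"])
      (use assms S Tr ear_links ear_meets in \<open>auto simp: numeral_2_eq_2[symmetric]\<close>)
  then show ?thesis by simp
qed

lemma ear_connected_colorings:
  assumes "E \<subseteq> V \<times> V" "u \<in> V" "w \<in> V" "u \<noteq> w" "(u, w) \<notin> E" "(w, u) \<notin> E"
    "connected_colorings 3 2 V E" "2 \<le> length p" "distinct p" "set p \<inter> V = {}"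
  shows "connected_colorings 3 2 (V \<union> set p) (E \<union> path_arcs (u # p @ [w]))"
  using assms
proof (induction p arbitrary: V E u)
  case (Cons x p)
  show ?case
  proof (cases "length p = 1")
    case True
    then obtain y where "p = [y]" by (cases p) auto
    then show ?thesis using ear_of_two_connected_colorings[of E V u w x y] Cons.prems by simp
  next
    case False
    let ?V = "insert x V" and ?E = "E \<union> {(u, x), (x, u)}"
    have "connected_colorings 3 2 (?V \<union> set p) (?E \<union> path_arcs (x # p @ [w]))"
    proof (rule Cons.IH)
      show "connected_colorings 3 2 ?V ?E"
        using Cons.prems by (intro leaf_connected_colorings) auto
      show "2 \<le> length p" using Cons.prems(8) False by (cases "length p") auto
    qed (use Cons.prems in auto)
    then show ?thesis by (simp add: Un_assoc insert_commute)
  qed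
qed simp

section \<open>Subdivisions\<close>

lemma cyclically_complete:
  assumes "distinct xs" "2 \<le> length xs" "\<And>x y. x \<in> set xs \<Longrightarrow> y \<in> set xs \<Longrightarrow> x \<noteq> y \<Longrightarrow> R x y"
  shows "cyclically R xs"
proof -
  have "successively R xs" using assms(1,3)
    by (induction xs rule: induct_list012) auto
  moreover have "last xs \<noteq> hd xs" "xs \<noteq> []" using assms(1,2) by (cases xs; auto)+
  ultimately show ?thesis using assms(3) by (auto simp: cyclically_def)
qed

lemma single_vertex_cyclic_colorings:
  assumes "3 \<le> k" "1 \<le> j"
  shows "cyclic_colorings k j {x} {}"
proof -
  define f :: "nat \<Rightarrow> 'a \<Rightarrow> nat" where "f c = (\<lambda>v. if v = x then c else undefined)" for c
  let ?xs = "map f [1..<Suc k]"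
  have "inj f" by (rule injI) (auto simp: f_def fun_eq_iff split: if_splits)
  then have dist: "distinct ?xs" by (simp add: distinct_map inj_on_subset)
  have set: "set ?xs = colorings k {x} {}"
  proof (intro equalityI subsetI)
    fix \<phi> assume "\<phi> \<in> colorings k {x} {}"
    then have \<phi>: "\<phi> \<in> {x} \<rightarrow>\<^sub>E {1..k}" by (simp add: colorings_def)
    then have "\<phi> = f (\<phi> x)" using PiE_arb[OF \<phi>] by (auto simp: f_def)
    moreover have "\<phi> x \<in> {1..k}" using \<phi> by auto
    ultimately show "\<phi> \<in> set ?xs" by (metis (no_types) atLeastLessThanSuc_atLeastAtMost image_eqI list.set_map set_upt)
  qed (auto simp: f_def colorings_def split: if_splits)
  have "recolor j {} \<phi> \<psi>" if "\<phi> \<in> set ?xs" "\<psi> \<in> set ?xs" "\<phi> \<noteq> \<psi>" for \<phi> \<psi>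
    using that assms(2) unfolding recolor_def
    by (intro conjI exI[of _ "[x]"]) (auto simp: f_def)
  moreover have "2 \<le> length ?xs" using assms(1) by simp
  ultimately have "cyclically (recolor j {}) ?xs" using cyclically_complete[OF dist] by blast
  then have "hamiltonian_cycle (colorings k {x} {}) (recolor j {}) ?xs"
    unfolding hamiltonian_cycle_def using dist set assms(1) by simp
  then show ?thesis unfolding cyclic_colorings_def by blast
qed

lemma isolated_vertex_cyclic_colorings:
  assumes "E \<subseteq> V \<times> V" "x \<notin> V" "cyclic_colorings k j V E" "3 \<le> k"
    and links: "links_joined k j 1 (distinct_link any_list) ([], [])"
  shows "cyclic_colorings k j (insert x V) E"
proof -
  interpret path_extension V E "[]" "[x]" "[]" by unfold_locales (use assms in auto)
  have state: "state \<phi> = ([], [])" for \<phi> by (simp add: state_def)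
  let ?F = "fibre k 1 ([], [])"
  from assms(3) obtain xs where xs: "hamiltonian_cycle (colorings k V E) (recolor j E) xs"
    unfolding cyclic_colorings_def by blast
  then have "3 \<le> length xs" by (simp add: hamiltonian_cycle_def)
  then obtain n where n: "length xs = Suc (Suc n)" by (metis Suc_le_D numeral_3_eq_3 Suc_le_mono)
  have "set ?F = (\<lambda>c. [c]) ` {1..k}"
    by (auto simp: set_fibre length_Suc_conv)
  then have card: "card (set ?F) = k" by (simp add: card_image inj_on_def)
  then obtain s where "s \<in> set ?F" using assms(4) by (metis card.empty equals0I not_numeral_le_zero)
  then have "chain (linked k 1 (distinct_link any_list)) s (replicate (Suc (Suc n)) ([], [])) s"
    using card assms(4) by (intro chain_replicate[where D = "set ?F"])
      (auto simp: linked_def distinct_link_def any_list_def)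
  moreover have "map state xs = replicate (Suc (Suc n)) ([], [])"
    by (rule replicate_eqI) (auto simp: state n)
  ultimately have "closed_chain (linked k 1 (distinct_link any_list)) (map state xs)"
    unfolding closed_chain_def by metis
  from hamiltonian_cycle_extension[OF xs this] show ?thesis
    using links_joined_sound[OF links] by (simp add: state cyclic_colorings_def)
qed

lemma isolated_vertex_connected_colorings:
  assumes "E \<subseteq> V \<times> V" "x \<notin> V" "connected_colorings 3 2 V E"
  shows "connected_colorings 3 2 (insert x V) E"
proof -
  interpret path_extension V E "[]" "[x]" "[]" by unfold_locales (use assms in auto)
  have "meets 1 3 1 any_list (([], []), ([], []))" by code_simp
  then have "connected_colorings 3 2 V' E'"
    by (intro connected_colorings_extension[where S = "[([], [])]" and Tr = "[(([], []), ([], []))]"])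
      (use assms isolated_links in \<open>auto simp: state_def\<close>)
  then show ?thesis by simp
qed

lemma edgeless_cyclic_colorings:
  assumes "finite V" "V \<noteq> {}" "(k = 3 \<and> j = 2) \<or> (k = 4 \<and> j = 1)"
  shows "cyclic_colorings k j V {}"
  using assms(1,2)
proof (induction V rule: finite_ne_induct)
  case (singleton x)
  show ?case using assms(3) by (intro single_vertex_cyclic_colorings) auto
next
  case (insert x V)
  then show ?case using isolated_links assms(3)
    by (intro isolated_vertex_cyclic_colorings) auto
qed

lemma edgeless_connected_colorings: "finite V \<Longrightarrow> connected_colorings 3 2 V {}"
proof (induction V rule: finite_induct)
  case empty
  then show ?case by (simp add: connected_colorings_def colorings_def)
next
  case (insert x V)
  then show ?case by (intro isolated_vertex_connected_colorings) auto
qed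

text \<open>Three colors suffice because only the last internal vertex has to avoid two colors;
  every earlier one avoids its predecessor.\<close>

lemma path_colors_exist:
  fixes k :: nat
  assumes "3 \<le> k" "2 \<le> n" "a \<in> {1..k}" "b \<in> {1..k}"
  shows "\<exists>cs. length cs = n \<and> set cs \<subseteq> {1..k} \<and> successively (\<noteq>) (a # cs @ [b])"
  using assms(2,3)
proof (induction n arbitrary: a rule: dec_induct)
  case base
  have other: "\<exists>c\<in>{1..k}. c \<noteq> d \<and> c \<noteq> e" for d e
  proof -
    have "1 \<in> {1..k}" "2 \<in> {1..k}" "3 \<in> {1..k}" using assms(1) by auto
    moreover have "(1 \<noteq> d \<and> 1 \<noteq> e) \<or> (2 \<noteq> d \<and> 2 \<noteq> e) \<or> (3 \<noteq> d \<and> 3 \<noteq> e)" by arith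
    ultimately show ?thesis by blast
  qed
  obtain c where c: "c \<in> {1..k}" "c \<noteq> a" using other by blast
  obtain d where d: "d \<in> {1..k}" "d \<noteq> c" "d \<noteq> b" using other by blast
  then show ?case using c by (intro exI[of _ "[c, d]"]) auto
next
  case (step n)
  have "\<exists>c\<in>{1..k}. c \<noteq> a" using assms(1) by (intro bexI[of _ "if a = 1 then 2 else 1"]) auto
  then obtain c where c: "c \<in> {1..k}" "c \<noteq> a" by blast
  from step.IH[OF c(1)] obtain cs where "length cs = n" "set cs \<subseteq> {1..k}"
    "successively (\<noteq>) (c # cs @ [b])" by blast
  then show ?case using c by (intro exI[of _ "c # cs"]) auto
qed

lemma ear_coloring_extends:
  assumes "E \<subseteq> V \<times> V" "u \<in> V" "w \<in> V" "3 \<le> k" "2 \<le> length p" "distinct p" "set p \<inter> V = {}"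
    "\<phi> \<in> colorings k V E"
  shows "\<exists>\<psi>\<in>colorings k (V \<union> set p) (E \<union> path_arcs (u # p @ [w])). \<forall>v\<in>V. \<psi> v = \<phi> v"
proof -
  interpret path_extension V E "[u]" p "[w]" by unfold_locales (use assms in auto)
  obtain cs where "length cs = length p" "set cs \<subseteq> {1..k}" "successively (\<noteq>) (\<phi> u # cs @ [\<phi> w])"
    using path_colors_exist[OF assms(4,5) coloringsD[OF assms(8,2)] coloringsD[OF assms(8,3)]] by blast
  then have cs: "cs \<in> Fib k \<phi>" by (simp add: state_def set_fibre)
  have "glue p \<phi> cs \<in> colorings k (V \<union> set p) (E \<union> path_arcs (u # p @ [w]))"
    using colorings_glue[OF assms(8) cs] by simp
  moreover have "glue p \<phi> cs v = \<phi> v" if "v \<in> V" for v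
    using that fibreD[OF cs] by (intro glue_old) simp
  ultimately show ?thesis by (intro bexI[of _ "glue p \<phi> cs"] ballI)
qed

text \<open>Besides \<open>P\<close>, the induction over the edges of \<open>M\<close> carries that
  no two branch vertices are adjacent and that every assignment of colors to them extends; the
  latter yields \<open>realizable\<close>.\<close>

lemma subdivision_induct:
  assumes "fin_digraph M" "is_subdivision M t H" "\<forall>e\<in>arcs M. l \<le> t e" "2 \<le> l" "3 \<le> k"
    and base: "P (verts M) {}"
    and step: "\<And>V E e q. P V E \<Longrightarrow> E \<subseteq> V \<times> V \<Longrightarrow> e \<in> arcs M \<Longrightarrow> tail M e \<in> V \<Longrightarrow> head M e \<in> V \<Longrightarrow>
      (tail M e, head M e) \<notin> E \<Longrightarrow> (head M e, tail M e) \<notin> E \<Longrightarrow>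
      realizable k V E (tail M e) (head M e) \<Longrightarrow> l \<le> length q \<Longrightarrow> distinct q \<Longrightarrow> set q \<inter> V = {} \<Longrightarrow>
      P (V \<union> set q) (E \<union> path_arcs (tail M e # q @ [head M e]))"
  shows "P (pverts H) (parcs H)"
proof -
  interpret fin_digraph M by fact
  obtain p where p: "\<And>e. e \<in> arcs M \<Longrightarrow> length (p e) = t e \<and> distinct (p e) \<and> set (p e) \<inter> verts M = {}"
    and disj: "\<And>e f. e \<in> arcs M \<Longrightarrow> f \<in> arcs M \<Longrightarrow> e \<noteq> f \<Longrightarrow> set (p e) \<inter> set (p f) = {}"
    and H: "pverts H = verts M \<union> (\<Union>e\<in>arcs M. set (p e))"
      "parcs H = (\<Union>e\<in>arcs M. path_arcs (tail M e # p e @ [head M e]))"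
    using assms(2) unfolding is_subdivision_def by (elim exE conjE) (rule that; simp)
  define W where "W S = verts M \<union> (\<Union>e\<in>S. set (p e))" for S
  define A where "A S = (\<Union>e\<in>S. path_arcs (tail M e # p e @ [head M e]))" for S
  have "P (W S) (A S) \<and> A S \<subseteq> W S \<times> W S \<and> A S \<inter> verts M \<times> verts M = {} \<and>
    (\<forall>f\<in>verts M \<rightarrow> {1..k}. \<exists>\<psi>\<in>colorings k (W S) (A S). \<forall>v\<in>verts M. \<psi> v = f v)"
    if "finite S" "S \<subseteq> arcs M" for S
    using that
  proof (induction S rule: finite_induct)
    case empty
    have "\<exists>\<psi>\<in>colorings k (verts M) {}. \<forall>v\<in>verts M. \<psi> v = f v" if "f \<in> verts M \<rightarrow> {1..k}" for f
      using that by (intro bexI[of _ "restrict f (verts M)"]) (auto simp: colorings_def)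
    then show ?case using base by (simp add: W_def A_def)
  next
    case (insert e S)
    then have IH: "P (W S) (A S)" "A S \<subseteq> W S \<times> W S" "A S \<inter> verts M \<times> verts M = {}"
      "\<And>f. f \<in> verts M \<rightarrow> {1..k} \<Longrightarrow> \<exists>\<psi>\<in>colorings k (W S) (A S). \<forall>v\<in>verts M. \<psi> v = f v"
      and e: "e \<in> arcs M" by auto
    let ?u = "tail M e" and ?w = "head M e"
    have uw: "?u \<in> verts M" "?w \<in> verts M" using e by auto
    then have uw': "?u \<in> W S" "?w \<in> W S" by (auto simp: W_def)
    have WA: "W (insert e S) = W S \<union> set (p e)" "A (insert e S) = A S \<union> path_arcs (?u # p e @ [?w])"
      by (auto simp: W_def A_def)
    have len: "l \<le> length (p e)" using p[OF e] assms(3) e by auto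
    have new: "set (p e) \<inter> W S = {}"
      using p[OF e] disj[OF e] insert.hyps(2) insert.prems by (fastforce simp: W_def)
    have real: "realizable k (W S) (A S) ?u ?w" unfolding realizable_def
    proof (intro ballI impI)
      fix c d assume "c \<in> {1..k}" "d \<in> {1..k}" "?u = ?w \<longrightarrow> c = d"
      moreover from this obtain \<phi> where "\<phi> \<in> colorings k (W S) (A S)"
        "\<forall>v\<in>verts M. \<phi> v = (if v = ?u then c else d)"
        using IH(4)[of "\<lambda>v. if v = ?u then c else d"] by auto
      ultimately show "\<exists>\<phi>\<in>colorings k (W S) (A S). \<phi> ?u = c \<and> \<phi> ?w = d"
        using uw by (intro bexI[of _ \<phi>]) auto
    qed
    have "path_arcs (?u # q @ [?w]) \<inter> verts M \<times> verts M = {}"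
      if q: "q \<noteq> []" "set q \<inter> verts M = {}" for q
    proof -
      obtain x q' where x: "q = x # q'" using q(1) by (cases q) auto
      have "path_arcs (q @ [?w]) \<subseteq> set q \<times> UNIV \<union> UNIV \<times> set q"
        by (induction q rule: induct_list012) auto
      then show ?thesis using q(2) x by auto
    qed
    from this[of "p e"] have "A (insert e S) \<inter> verts M \<times> verts M = {}"
      unfolding WA Int_Un_distrib2 using IH(3) p[OF e] len assms(4) by force
    moreover have "P (W (insert e S)) (A (insert e S))"
      unfolding WA using IH uw uw' e len new real p[OF e] by (intro step) auto
    moreover have "A (insert e S) \<subseteq> W (insert e S) \<times> W (insert e S)"
      unfolding WA using IH(2) uw' path_arcs_subset[of "?u # p e @ [?w]"] by fastforce
    moreover have "\<exists>\<psi>\<in>colorings k (W (insert e S)) (A (insert e S)). \<forall>v\<in>verts M. \<psi> v = f v"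
      if f: "f \<in> verts M \<rightarrow> {1..k}" for f
    proof -
      obtain \<phi> where \<phi>: "\<phi> \<in> colorings k (W S) (A S)" "\<forall>v\<in>verts M. \<phi> v = f v" using IH(4)[OF f] by blast
      obtain \<psi> where "\<psi> \<in> colorings k (W (insert e S)) (A (insert e S))" "\<forall>v\<in>W S. \<psi> v = \<phi> v"
        using ear_coloring_extends[OF IH(2) uw' assms(5) _ _ new \<phi>(1)] p[OF e] len assms(4)
        unfolding WA by auto
      then show ?thesis using \<phi>(2) by (intro bexI[of _ \<psi>]) (auto simp: W_def)
    qed
    ultimately show ?case by blast
  qed
  from this[of "arcs M"] show ?thesis unfolding H W_def A_def by simp
qed

section \<open>The coloring graph\<close>

lemma sym_path_arcs: "sym (path_arcs q)"
  by (simp add: path_arcs_def sym_Un_converse)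

lemma colorings_eq: "proper_colorings k H = colorings k (pverts H) (parcs H)"
  by (simp add: proper_colorings_def colorings_def)

lemma connected_path2:
  assumes "q = [x] \<or> q = [x, y]"
  shows "connected (with_proj \<lparr>pverts = set q, parcs = path_arcs q\<rparr>)"
proof -
  let ?S = "\<lparr>pverts = set q, parcs = path_arcs q\<rparr>"
  have wf: "wf_digraph (with_proj (mk_symmetric (with_proj ?S)))"
    using assms by unfold_locales (auto simp: parcs_mk_symmetric)
  show ?thesis
    unfolding connected_def strongly_connected_def
    using assms wf_digraph.reachable_refl[OF wf] wf_digraph.reachable_adjI[OF wf]
    by (auto simp: parcs_mk_symmetric)
qed

lemma coloring_graph_arcI:
  assumes H: "parcs H \<subseteq> pverts H \<times> pverts H" "sym (parcs H)" and "j \<le> 2"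
    and col: "\<phi> \<in> proper_colorings k H" "\<psi> \<in> proper_colorings k H" and "recolor j (parcs H) \<phi> \<psi>"
  shows "(\<phi>, \<psi>) \<in> parcs (coloring_graph k j H)"
proof -
  obtain q where q: "distinct q" "length q \<le> j" "successively (\<lambda>x y. (x, y) \<in> parcs H) q"
    "{v. \<phi> v \<noteq> \<psi> v} \<subseteq> set q" and ne: "\<phi> \<noteq> \<psi>"
    using assms(6) unfolding recolor_def by blast
  have diff: "\<exists>v\<in>pverts H. \<phi> v \<noteq> \<psi> v"
    using col ne unfolding proper_colorings_def by (metis (no_types, lifting) PiE_ext mem_Collect_eq)
  have "length q \<le> 2" using q(2) assms(3) by simp
  with diff q(4) consider x where "q = [x]" | x y where "q = [x, y]"
    by (cases q rule: remdups_adj.cases) auto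
  then have path: "\<exists>x y. q = [x] \<or> q = [x, y]" and V: "set q \<subseteq> pverts H" and A: "path_arcs q \<subseteq> parcs H"
    using q(3,4) diff H by (cases; auto dest: symD)+
  let ?S = "\<lparr>pverts = set q, parcs = path_arcs q\<rparr>"
  have S: "pair_graph ?S"
    using path q(1) by unfold_locales (auto simp: symmetric_def intro!: symI)
  have "subgraph (with_proj ?S) (with_proj H)"
  proof -
    have "wf_digraph (with_proj H)" by unfold_locales (use H(1) in auto)
    moreover have "wf_digraph (with_proj ?S)" by unfold_locales (use path_arcs_subset[of q] in auto)
    ultimately show ?thesis using V A by (simp add: subgraph_def compatible_def)
  qed
  moreover have "connected (with_proj ?S)" using path connected_path2[of q] by auto
  moreover have "card (pverts ?S) \<le> j" using q(2) card_length[of q] by simp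
  moreover have "{v \<in> pverts H. \<phi> v \<noteq> \<psi> v} \<subseteq> pverts ?S" using q(4) by auto
  ultimately have "\<exists>S. pair_graph S \<and> subgraph (with_proj S) (with_proj H) \<and>
      connected (with_proj S) \<and> card (pverts S) \<le> j \<and> {v \<in> pverts H. \<phi> v \<noteq> \<psi> v} \<subseteq> pverts S"
    using S by blast
  then show ?thesis using col ne by (simp add: coloring_graph_def)
qed

text \<open>A walk is a list of arcs, here obtained by zipping its vertex list with the shifted
  list.\<close>

lemma cyclic_walk:
  "pcas x (zip (x # ys) (ys @ [z])) z \<and> pawalk_verts x (zip (x # ys) (ys @ [z])) = x # ys @ [z]"
  by (induction ys arbitrary: x) auto

lemma successively_zip: "successively R (x # ys @ [z]) \<Longrightarrow> \<forall>(a, b)\<in>set (zip (x # ys) (ys @ [z])). R a b"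
  by (induction ys arbitrary: x) auto

lemma hamiltonian_coloring_graph:
  assumes H: "parcs H \<subseteq> pverts H \<times> pverts H" "sym (parcs H)" and "j \<le> 2"
    and ham: "cyclic_colorings k j (pverts H) (parcs H)"
  shows "hamiltonian (coloring_graph k j H)"
proof -
  let ?G = "coloring_graph k j H"
  from ham obtain xs where xs: "distinct xs" "set xs = proper_colorings k H" "3 \<le> length xs"
    "cyclically (recolor j (parcs H)) xs"
    unfolding cyclic_colorings_def hamiltonian_cycle_def colorings_eq by blast
  obtain x ys where eq: "xs = x # ys" using xs(3) by (cases xs) auto
  let ?c = "zip (x # ys) (ys @ [x])"
  have V: "pverts ?G = set xs" by (simp add: coloring_graph_def xs(2))
  have "successively (\<lambda>\<phi> \<psi>. (\<phi>, \<psi>) \<in> parcs ?G) (x # ys @ [x])"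
  proof -
    have "successively (recolor j (parcs H)) (x # ys @ [x])"
      using xs(4) unfolding eq cyclically_def
      by (simp add: successively_append_iff flip: append_Cons)
    then show ?thesis
      by (rule successively_mono) (use xs eq H assms(3) in \<open>auto intro!: coloring_graph_arcI\<close>)
  qed
  then have "set ?c \<subseteq> parcs ?G" using successively_zip[of "\<lambda>\<phi> \<psi>. (\<phi>, \<psi>) \<in> parcs ?G" x ys x] by auto
  then have "pre_digraph.cycle (with_proj ?G) ?c"
    using cyclic_walk[of x ys x] xs(1) V unfolding eq
    by (auto simp: pre_digraph.cycle_def pre_digraph.awalk_def cas_with_proj_eq awalk_verts_with_proj_eq)
  moreover have "fst ` set ?c = pverts ?G"
    unfolding V eq by (simp only: flip: set_map) simp
  moreover have "3 \<le> length ?c" using xs(3) eq by simp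
  ultimately show ?thesis unfolding hamiltonian_def by blast
qed

lemma connected_coloring_graph:
  assumes H: "parcs H \<subseteq> pverts H \<times> pverts H" "sym (parcs H)" and "j \<le> 2"
    and conn: "connected_colorings k j (pverts H) (parcs H)" and "proper_colorings k H \<noteq> {}"
  shows "connected (with_proj (coloring_graph k j H))"
proof -
  let ?G = "coloring_graph k j H"
  have wf: "wf_digraph (with_proj ?G)" by unfold_locales (auto simp: coloring_graph_def)
  have "\<phi> \<rightarrow>\<^sup>*\<^bsub>with_proj ?G\<^esub> \<psi>"
    if "(\<lambda>\<phi> \<psi>. \<phi> \<in> proper_colorings k H \<and> \<psi> \<in> proper_colorings k H \<and> recolor j (parcs H) \<phi> \<psi>)\<^sup>*\<^sup>* \<phi> \<psi>"
      "\<phi> \<in> proper_colorings k H" for \<phi> \<psi>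
    using that
  proof (induction rule: rtranclp_induct)
    case base
    then show ?case using wf_digraph.reachable_refl[OF wf] by (simp add: coloring_graph_def)
  next
    case (step \<psi> \<upsilon>)
    then have "(\<psi>, \<upsilon>) \<in> parcs ?G" using coloring_graph_arcI[OF H assms(3)] by blast
    then show ?case using step wf_digraph.reachable_adj_trans[OF wf] by simp
  qed
  then show ?thesis
    using conn assms(5) wf_digraph.reachable_mk_symmetricI[OF wf]
    unfolding connected_def strongly_connected_def connected_colorings_def colorings_eq[symmetric]
    by (auto simp: coloring_graph_def)
qed

text \<open>Without vertices there is exactly one coloring, so no cycle of length 3 exists and the
  convention on complete graphs has to step in.\<close>

lemma hamiltonian_null_graph:
  assumes "pverts H = {}" "parcs H = {}"
  shows "hamiltonian (coloring_graph k j H)"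
proof -
  have "proper_colorings k H = {\<lambda>_. undefined}" using assms by (auto simp: proper_colorings_def)
  then show ?thesis
    by (auto simp: hamiltonian_def coloring_graph_def complete_digraph_pair_def)
qed

theorem mainTheorem3:
  fixes M :: "('a, 'e) pre_digraph" and H :: "'a pair_pre_digraph"
    and t :: "'e \<Rightarrow> nat" and l :: nat
  assumes "fin_digraph M"
    and "is_subdivision M t H"
    and "\<forall>e \<in> arcs M. l \<le> t e"
  shows "(l = 2 \<and> loopfree_digraph M \<longrightarrow> gray_g 3 H \<le> 2 \<and> gray_h 4 H = 1)
    \<and> (l = 3 \<longrightarrow> gray_h 3 H \<le> 2)"
proof -
  interpret fin_digraph M by fact
  note induct = subdivision_induct[OF assms]
  have wf: "parcs H \<subseteq> pverts H \<times> pverts H \<and> sym (parcs H)" if "2 \<le> l"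
  proof (rule induct[OF that order_refl, where P = "\<lambda>V E. E \<subseteq> V \<times> V \<and> sym E"])
    fix V E e q assume "E \<subseteq> V \<times> V \<and> sym E" "tail M e \<in> V" "head M e \<in> V"
    moreover from this have "set (tail M e # q @ [head M e]) \<subseteq> V \<union> set q" by auto
    ultimately show "E \<union> path_arcs (tail M e # q @ [head M e]) \<subseteq> (V \<union> set q) \<times> (V \<union> set q) \<and>
        sym (E \<union> path_arcs (tail M e # q @ [head M e]))"
      using path_arcs_subset[of "tail M e # q @ [head M e]"] by (blast intro: sym_Un sym_path_arcs)
  qed (auto simp: sym_def)
  have null: "hamiltonian (coloring_graph k j H)" if "verts M = {}" for k j
  proof -
    have "arcs M = {}" using that wellformed by auto
    then show ?thesis using assms(2) that
      by (intro hamiltonian_null_graph) (auto simp: is_subdivision_def)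
  qed
  \<comment> \<open>A loop with two internal vertices defeats the method. With 3 colors its fibres
    for two colors of the branch vertex are disjoint; with 4 colors they share only two antipodal
    elements of a 6-cycle, which no Hamiltonian path joins.\<close>
  have no_loops: "tail M e \<noteq> head M e" if "loopfree_digraph M" "e \<in> arcs M" for e
    using loopfree_digraph.no_loops[OF that] .
  have g: "connected (with_proj (coloring_graph 3 2 H))" if "2 \<le> l" "loopfree_digraph M"
  proof (rule connected_coloring_graph)
    show "connected_colorings 3 2 (pverts H) (parcs H)"
      by (rule induct[OF that(1) order_refl])
        (use that no_loops[OF that(2)] in
          \<open>auto intro!: ear_connected_colorings edgeless_connected_colorings\<close>)
    \<comment> \<open>\<open>connected\<close> demands a nonempty vertex set, so the existence of a
      coloring is a separate obligation.\<close>
    have "colorings 3 (pverts H) (parcs H) \<noteq> {}"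
    proof (rule induct[OF that(1) order_refl, where P = "\<lambda>V E. colorings 3 V E \<noteq> {}"])
      have "restrict (\<lambda>_. 1) (verts M) \<in> colorings 3 (verts M) {}" by (auto simp: colorings_def)
      then show "colorings 3 (verts M) {} \<noteq> {}" by blast
    next
      fix V E e q assume "colorings 3 V E \<noteq> {}" "E \<subseteq> V \<times> V" "tail M e \<in> V" "head M e \<in> V"
        "l \<le> length q" "distinct q" "set q \<inter> V = {}"
      then show "colorings 3 (V \<union> set q) (E \<union> path_arcs (tail M e # q @ [head M e])) \<noteq> {}"
        using that(1) ear_coloring_extends[of E V "tail M e" "head M e" 3 q] by fastforce
    qed
    then show "proper_colorings 3 H \<noteq> {}" by (simp add: colorings_eq)
  qed (use wf that in auto)
  have h4: "hamiltonian (coloring_graph 4 1 H)" if "2 \<le> l" "loopfree_digraph M"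
  proof (cases "verts M = {}")
    case False
    have "cyclic_colorings 4 1 (pverts H) (parcs H)"
    proof (rule induct[OF that(1), where k = 4])
      show "cyclic_colorings 4 1 (verts M) {}" using False by (intro edgeless_cyclic_colorings) auto
    next
      fix V E e q assume "cyclic_colorings 4 1 V E" "E \<subseteq> V \<times> V" "e \<in> arcs M" "tail M e \<in> V" "head M e \<in> V"
        "realizable 4 V E (tail M e) (head M e)" "l \<le> length q" "distinct q" "set q \<inter> V = {}"
      then show "cyclic_colorings 4 1 (V \<union> set q) (E \<union> path_arcs (tail M e # q @ [head M e]))"
        using that(1) no_loops[OF that(2)] by (intro ear_cyclic_colorings_4) auto
    qed simp
    then show ?thesis using wf that by (intro hamiltonian_coloring_graph) auto
  qed (rule null)
  have h3: "hamiltonian (coloring_graph 3 2 H)" if "3 \<le> l"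
  proof (cases "verts M = {}")
    case False
    have "cyclic_colorings 3 2 (pverts H) (parcs H)"
    proof (rule induct[OF _ order_refl, where P = "cyclic_colorings 3 2"])
      show "cyclic_colorings 3 2 (verts M) {}" using False by (intro edgeless_cyclic_colorings) auto
    next
      fix V E e q assume "cyclic_colorings 3 2 V E" "E \<subseteq> V \<times> V" "tail M e \<in> V" "head M e \<in> V"
        "(tail M e, head M e) \<notin> E" "(head M e, tail M e) \<notin> E"
        "realizable 3 V E (tail M e) (head M e)" "l \<le> length q" "distinct q" "set q \<inter> V = {}"
      then show "cyclic_colorings 3 2 (V \<union> set q) (E \<union> path_arcs (tail M e # q @ [head M e]))"
        using that by (intro ear_cyclic_colorings_3) auto
    qed (use that in simp)
    then show ?thesis using wf that by (intro hamiltonian_coloring_graph) auto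
  qed (rule null)
  have "gray_g 3 H \<le> 2" if "2 \<le> l" "loopfree_digraph M"
    using g[OF that] unfolding gray_g_def
    by (intro INF_lower2[of 2]) (auto simp: numeral_eq_enat)
  moreover have "gray_h 4 H = 1" if "2 \<le> l" "loopfree_digraph M"
  proof (rule antisym)
    show "gray_h 4 H \<le> 1" using h4[OF that] unfolding gray_h_def
      by (intro INF_lower2[of 1]) (auto simp: one_enat_def)
    show "1 \<le> gray_h 4 H" unfolding gray_h_def
      by (intro INF_greatest) (auto simp: one_enat_def)
  qed
  moreover have "gray_h 3 H \<le> 2" if "3 \<le> l"
    using h3[OF that] unfolding gray_h_def
    by (intro INF_lower2[of 2]) (auto simp: numeral_eq_enat)
  ultimately show ?thesis by simp
qed

end
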